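(* Let $q$ be an odd prime power, let $m=4t+2\ge2$ for an integer $t\ge0$, and let $n=q^{m}+1$. Then: (1) For every integer $\delta$ with $\delta_{3,n}+1\le\delta\le\delta_{2,n}$, the code $\mathcal{C}_{(n,q,\delta,1)}$ is an LCD code with parameters $[n,6,d\ge\delta_{3,n}]$; for every integer $\delta$ with $\delta_{4,n}+1\le\delta\le\delta_{3,n}$, it is an LCD code with parameters $[n,2m+6,d\ge\delta_{4,n}]$. (2) For every integer $\delta$ with $\delta_{3,n}+1\le\delta\le\delta_{2,n}$, the code $\mathcal{C}_{(n,q,\delta+1,0)}$ is an LCD code with parameters $[n,5,d\ge2\delta_{3,n}]$; for every integer $\delta$ with $\delta_{4,n}+1\le\delta\le\delta_{3,n}$, it is an LCD code with parameters $[n,2m+5,d\ge2\delta_{4,n}]$.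
   Context: Let $q$ be a prime power and $n\ge2$ an integer with $\gcd(n,q)=1$. Let $\ell=\mathrm{ord}_n(q)$, let $\alpha$ be a generator of $\mathbb{F}_{q^\ell}^*$, $\beta=\alpha^{(q^\ell-1)/n}$, and let $m_i(x)$ be the minimal polynomial of $\beta^i$ over $\mathbb{F}_q$. For integers $b\ge0$ and $2\le\delta\le n$, $\mathcal{C}_{(n,q,\delta,b)}$ denotes the cyclic code of length $n$ over $\mathbb{F}_q$ with generator polynomial $\mathrm{lcm}(m_b(x),\dots,m_{b+\delta-2}(x))$. A linear code $\mathcal{C}$ is LCD if $\mathcal{C}\cap\mathcal{C}^{\perp}=\{0\}$ (Euclidean dual). $[n,k,d\ge D]$ means length $n$, dimension $k$, minimum Hamming distance at least $D$. For $0\le s\le n-1$, $C_s=\{sq^i\bmod n:0\le i\le\ell-1\}$ is the $q$-cyclotomic coset of $s$ modulo $n$; its least element is its coset leader; $\mathrm{MinRep}_n$ is the set of all coset leaders modulo $n$ (including $0$), and $\delta_{i,n}$ is the $i$-th largest element of $\mathrm{MinRep}_n$. *)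

theory Defs
  imports "HOL-Computational_Algebra.Polynomial_Factorial" "HOL-Number_Theory.Pocklington"
begin

definition prime_power :: "nat \<Rightarrow> bool" where
  "prime_power q \<longleftrightarrow> (\<exists>p k. prime p \<and> k > 0 \<and> q = p ^ k)"

definition primitive_elem :: "'b::field \<Rightarrow> bool" where
  "primitive_elem \<alpha> \<longleftrightarrow> \<alpha> \<noteq> 0 \<and> (\<forall>x. x \<noteq> 0 \<longrightarrow> (\<exists>k::nat. \<alpha> ^ k = x))"

(* the subfield F_q of a field of order q^l *)
definition subfield_q :: "nat \<Rightarrow> 'b::field set" where
  "subfield_q q = {x. x ^ q = x}"

definition poly_over :: "'b::field set \<Rightarrow> 'b poly \<Rightarrow> bool" where
  "poly_over F p \<longleftrightarrow> (\<forall>i. Polynomial.coeff p i \<in> F)"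

definition minpoly :: "'b::field set \<Rightarrow> 'b \<Rightarrow> 'b poly" where
  "minpoly F \<gamma> = (THE p. lead_coeff p = 1 \<and> poly_over F p \<and> poly p \<gamma> = 0 \<and>
      (\<forall>p'. p' \<noteq> 0 \<and> poly_over F p' \<and> poly p' \<gamma> = 0 \<longrightarrow> degree p \<le> degree p'))"

definition words :: "'b::field set \<Rightarrow> nat \<Rightarrow> (nat \<Rightarrow> 'b) set" where
  "words F n = {c. (\<forall>i. c i \<in> F) \<and> (\<forall>i\<ge>n. c i = 0)}"

definition word_poly :: "nat \<Rightarrow> (nat \<Rightarrow> 'b::field) \<Rightarrow> 'b poly" where
  "word_poly n c = (\<Sum>i<n. Polynomial.monom (c i) i)"

definition gen_poly :: "'b::field_gcd set \<Rightarrow> 'b \<Rightarrow> nat \<Rightarrow> nat \<Rightarrow> 'b poly" where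
  "gen_poly F \<beta> \<delta> b = Lcm ((\<lambda>i. minpoly F (\<beta> ^ i)) ` {b..b + \<delta> - 2})"

definition cyclic_code :: "'b::field set \<Rightarrow> nat \<Rightarrow> 'b poly \<Rightarrow> (nat \<Rightarrow> 'b) set" where
  "cyclic_code F n g = {c \<in> words F n. \<exists>h. poly_over F h \<and> word_poly n c = g * h}"

definition BCH_code :: "nat \<Rightarrow> nat \<Rightarrow> 'b::field_gcd \<Rightarrow> nat \<Rightarrow> nat \<Rightarrow> (nat \<Rightarrow> 'b) set" where
  "BCH_code n q \<alpha> \<delta> b =
     cyclic_code (subfield_q q) n
       (gen_poly (subfield_q q) (\<alpha> ^ ((q ^ ord n q - 1) div n)) \<delta> b)"

definition dot :: "nat \<Rightarrow> (nat \<Rightarrow> 'b::field) \<Rightarrow> (nat \<Rightarrow> 'b) \<Rightarrow> 'b" where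
  "dot n x y = (\<Sum>i<n. x i * y i)"

definition dual_code :: "'b::field set \<Rightarrow> nat \<Rightarrow> (nat \<Rightarrow> 'b) set \<Rightarrow> (nat \<Rightarrow> 'b) set" where
  "dual_code F n C = {x \<in> words F n. \<forall>c\<in>C. dot n x c = 0}"

definition is_LCD :: "'b::field set \<Rightarrow> nat \<Rightarrow> (nat \<Rightarrow> 'b) set \<Rightarrow> bool" where
  "is_LCD F n C \<longleftrightarrow> C \<inter> dual_code F n C = {\<lambda>_. 0}"

definition lin_comb :: "(nat \<Rightarrow> 'b::field) set \<Rightarrow> ((nat \<Rightarrow> 'b) \<Rightarrow> 'b) \<Rightarrow> nat \<Rightarrow> 'b" where
  "lin_comb B f = (\<lambda>i. \<Sum>v\<in>B. f v * v i)"

definition F_span :: "'b::field set \<Rightarrow> (nat \<Rightarrow> 'b) set \<Rightarrow> (nat \<Rightarrow> 'b) set" where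
  "F_span F B = {lin_comb B f | f. \<forall>v\<in>B. f v \<in> F}"

definition F_indep :: "'b::field set \<Rightarrow> (nat \<Rightarrow> 'b) set \<Rightarrow> bool" where
  "F_indep F B \<longleftrightarrow> (\<forall>f. (\<forall>v\<in>B. f v \<in> F) \<and> lin_comb B f = (\<lambda>_. 0) \<longrightarrow> (\<forall>v\<in>B. f v = 0))"

definition code_dim :: "'b::field set \<Rightarrow> (nat \<Rightarrow> 'b) set \<Rightarrow> nat \<Rightarrow> bool" where
  "code_dim F C k \<longleftrightarrow> (\<exists>B. B \<subseteq> C \<and> finite B \<and> card B = k \<and> F_indep F B \<and> F_span F B = C)"

definition weight :: "(nat \<Rightarrow> 'b::zero) \<Rightarrow> nat" where
  "weight c = card {i. c i \<noteq> 0}"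

definition min_dist_ge :: "(nat \<Rightarrow> 'b::zero) set \<Rightarrow> nat \<Rightarrow> bool" where
  "min_dist_ge C D \<longleftrightarrow> (\<forall>c\<in>C. c \<noteq> (\<lambda>_. 0) \<longrightarrow> D \<le> weight c)"

definition LCD_params :: "nat \<Rightarrow> (nat \<Rightarrow> 'b::field) set \<Rightarrow> nat \<Rightarrow> nat \<Rightarrow> nat \<Rightarrow> bool" where
  "LCD_params q C n k D \<longleftrightarrow>
     is_LCD (subfield_q q) n C \<and> code_dim (subfield_q q) C k \<and> min_dist_ge C D"

definition cyc_coset :: "nat \<Rightarrow> nat \<Rightarrow> nat \<Rightarrow> nat set" where
  "cyc_coset q n s = {s * q ^ i mod n | i. i < ord n q}"

definition MinRep :: "nat \<Rightarrow> nat \<Rightarrow> nat set" where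
  "MinRep q n = {s. s < n \<and> s = Min (cyc_coset q n s)}"

definition delta_leader :: "nat \<Rightarrow> nat \<Rightarrow> nat \<Rightarrow> nat" where
  "delta_leader q n i = rev (sorted_list_of_set (MinRep q n)) ! (i - 1)"

end

theory Submission
  imports Defs
begin

text \<open>
  Put \<open>n = q ^ m + 1 = 2 * h\<close>. Since \<open>q ^ m\<close> is \<open>-1\<close> modulo \<open>n\<close>, the leader of the coset of \<open>s\<close> is
  \<open>h - max r\<^sub>i\<close>, where \<open>r\<^sub>i\<close> is the balanced absolute residue of \<open>q ^ i * (h - s)\<close>. With
  \<open>N = n / (q\<^sup>2 + 1)\<close>, a residue \<open>r\<close> slightly above \<open>q * N\<close> is sent below \<open>q * N\<close> by \<open>q\<^sup>2\<close> and above
  \<open>q * N\<close> again by \<open>q ^ 4\<close>, which contradicts \<open>r\<^sub>i\<^sub>+\<^sub>m = r\<^sub>i\<close> because \<open>m\<close> is 2 modulo 4; and an orbit whose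
  residues are all at most \<open>q * N\<close> must contain \<open>q * N\<close>. Hence the second largest leader is \<open>h - q * N\<close>,
  with a coset of size 4, and for \<open>m \<ge> 6\<close> the third largest one is \<open>h - E\<close> for an explicit \<open>E\<close> whose
  residues \<open>r\<^sub>i\<close>, \<open>0 < i < m\<close>, are all smaller than \<open>E\<close>, so that its coset has the full size \<open>2 * m\<close>. The
  dimensions follow by counting the exponents that are not zeros of the code.

  A word \<open>x\<close> in the code and its dual is orthogonal to its own cyclic shifts, that is,
  \<open>x(\<beta> ^ j) * x(\<beta> ^ -j) = 0\<close> for all \<open>j\<close>. The zeros of \<open>x\<close> are closed under negation of exponents, so all
  \<open>x(\<beta> ^ j)\<close> vanish and \<open>x = 0\<close>. The same closure doubles the run of consecutive zeros when 1 is a zero.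
\<close>

section \<open>Balanced residues\<close>

text \<open>The distance from \<open>x\<close> to the nearest multiple of \<open>n\<close>. It
  ignores signs, so for \<open>n = q ^ m + 1\<close> multiplication by \<open>q ^ m\<close> leaves
  it unchanged.\<close>

definition bnorm :: "int \<Rightarrow> int \<Rightarrow> int" where
  "bnorm n x = min (x mod n) (n - x mod n)"

lemma bnorm_nonneg: "n > 0 \<Longrightarrow> 0 \<le> bnorm n x"
  unfolding bnorm_def using pos_mod_bound[of n x] pos_mod_sign[of n x] by linarith

lemma bnorm_le_half: "2 * bnorm n x \<le> n"
  unfolding bnorm_def min_def by simp

lemma bnorm_cases: "n dvd x - bnorm n x \<or> n dvd x + bnorm n x"
proof -
  have "n dvd x - x mod n" by (simp add: minus_mod_eq_mult_div)
  moreover have "x + (n - x mod n) = (x - x mod n) + n" by simp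
  ultimately have "n dvd x - x mod n" "n dvd x + (n - x mod n)"
    by (metis, metis dvd_add dvd_refl)
  then show ?thesis unfolding bnorm_def min_def by auto
qed

lemma bnorm_eqI:
  assumes "n > 0" "0 \<le> r" "2 * r \<le> n" "n dvd x - r \<or> n dvd x + r"
  shows "bnorm n x = r"
  using assms(4)
proof
  assume "n dvd x - r"
  then have "x mod n = r mod n" by (simp add: mod_eq_dvd_iff)
  then show ?thesis using assms unfolding bnorm_def by simp
next
  assume "n dvd x + r"
  then have "x mod n = (- r) mod n" by (simp add: mod_eq_dvd_iff)
  then show ?thesis
    using assms unfolding bnorm_def by (cases "r = 0") (auto simp: zmod_zminus1_eq_if)
qed

lemma bnorm_eq_abs:
  assumes "n > 0" "2 * \<bar>v\<bar> \<le> n" "n dvd x - v \<or> n dvd x + v"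
  shows "bnorm n x = \<bar>v\<bar>"
  using assms by (intro bnorm_eqI) (auto simp: abs_if)

lemma bnorm_cong:
  assumes "n > 0" "n dvd x - y \<or> n dvd x + y"
  shows "bnorm n x = bnorm n y"
proof -
  have "n dvd x - bnorm n y \<or> n dvd x + bnorm n y"
  proof -
    have "x - bnorm n y = (x - y) + (y - bnorm n y)" "x - bnorm n y = (x + y) - (y + bnorm n y)"
      "x + bnorm n y = (x - y) + (y + bnorm n y)" "x + bnorm n y = (x + y) - (y - bnorm n y)"
      by simp_all
    then show ?thesis using assms(2) bnorm_cases[of n y] dvd_add dvd_diff by metis
  qed
  then show ?thesis
    using assms(1) bnorm_eqI bnorm_nonneg bnorm_le_half by blast
qed

text \<open>Lets the residue at \<open>i + k\<close> be computed from the one at \<open>i\<close>,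
  although passing to a residue forgets the sign.\<close>

lemma bnorm_mult:
  assumes "n > 0" shows "bnorm n (a * bnorm n x) = bnorm n (a * x)"
proof (rule bnorm_cong[OF assms])
  have "a * bnorm n x - a * x = - (a * (x - bnorm n x))"
    "a * bnorm n x + a * x = a * (x + bnorm n x)" by (simp_all add: algebra_simps)
  then show "n dvd a * bnorm n x - a * x \<or> n dvd a * bnorm n x + a * x"
    using bnorm_cases[of n x] by (metis dvd_minus_iff dvd_mult)
qed

lemma bnorm_eq_0_iff: "n > 0 \<Longrightarrow> bnorm n x = 0 \<longleftrightarrow> n dvd x"
  using bnorm_cases[of n x] bnorm_eqI[of n 0 x] by auto

text \<open>Since \<open>q ^ 2 * (q * N)\<close> is \<open>q * n - q * N\<close>, multiplication by
  \<open>q ^ 2\<close> reflects the point \<open>q * N\<close> and turns an excess \<open>u\<close>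
  over it into \<open>- (q ^ 2 * u)\<close>. The bound on \<open>r\<close> says exactly that
  \<open>q ^ 4 * u < n - 2 * q * N\<close>, so after two reflections the value is still below
  \<open>n - q * N\<close>.\<close>

lemma bnorm_step:
  assumes n: "n > 0" and q: "q > 0" and s: "(q\<^sup>2 + 1) * N = n" "N > 0"
    and r: "q * N < r" "r * (q ^ 4 * (q\<^sup>2 + 1)) < n * (q ^ 5 + (q - 1)\<^sup>2)"
  shows "bnorm n (q\<^sup>2 * r) < q * N" "bnorm n (q ^ 4 * r) > q * N"
proof -
  define u where "u = r - q * N"
  have u: "u > 0" "r = q * N + u" using r by (auto simp: u_def)
  have "(q\<^sup>2 + 1) * (q ^ 4 * u) < (q\<^sup>2 + 1) * (N * (q - 1)\<^sup>2)"
    using r(2) unfolding u(2) s(1)[symmetric]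
    by (simp add: algebra_simps eval_nat_numeral)
  then have b4: "q ^ 4 * u < N * (q - 1)\<^sup>2"
    by (rule mult_less_cancel_left_pos[THEN iffD1, rotated]) (simp add: add_nonneg_pos)
  also have "\<dots> \<le> N * q\<^sup>2" using q s(2) by (intro mult_left_mono power_mono) auto
  finally have "q\<^sup>2 * (q\<^sup>2 * u) < q\<^sup>2 * N" by (simp add: algebra_simps eval_nat_numeral)
  then have b2: "q\<^sup>2 * u < N"
    by (rule mult_less_cancel_left_pos[THEN iffD1, rotated]) (use q in simp)
  have Nq: "N \<le> q * N" using q s(2) by simp
  have "q\<^sup>2 * r + (q * N - q\<^sup>2 * u) = n * q"
    unfolding u s(1)[symmetric] by (simp add: algebra_simps eval_nat_numeral)
  then have d: "n dvd q\<^sup>2 * r + (q * N - q\<^sup>2 * u)" by simp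
  have "2 * (q * N) \<le> (q\<^sup>2 + 1) * N"
  proof -
    have "0 \<le> (q - 1)\<^sup>2 * N" using s(2) by simp
    then show ?thesis by (simp add: algebra_simps eval_nat_numeral)
  qed
  then have h: "2 * (q * N) \<le> n" using s by simp
  have "q\<^sup>2 * u > 0" using u q by simp
  moreover have "bnorm n (q\<^sup>2 * r) = q * N - q\<^sup>2 * u"
    using d h \<open>q\<^sup>2 * u > 0\<close> n order.trans[OF less_imp_le[OF b2] Nq] by (intro bnorm_eqI) auto
  ultimately show "bnorm n (q\<^sup>2 * r) < q * N" by simp
  have "q ^ 4 * r - (q * N + q ^ 4 * u) = n * (q ^ 3 - q)"
    unfolding u s(1)[symmetric] by (simp add: algebra_simps eval_nat_numeral)
  then have "bnorm n (q ^ 4 * r) = bnorm n (q * N + q ^ 4 * u)"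
    using n by (intro bnorm_cong) auto
  moreover have "q ^ 4 * u > 0" using u q by simp
  moreover have "q * N + q ^ 4 * u < n - q * N"
    using b4 unfolding s(1)[symmetric] by (simp add: algebra_simps eval_nat_numeral)
  moreover from this have "(q * N + q ^ 4 * u) mod n = q * N + q ^ 4 * u"
    using mult_pos_pos[OF q s(2)] \<open>q ^ 4 * u > 0\<close> by (intro mod_pos_pos_trivial) linarith+
  ultimately show "bnorm n (q ^ 4 * r) > q * N" unfolding bnorm_def by simp
qed

text \<open>A residue above \<open>q * N\<close> stays above it every four steps but is below it two
  steps later, which the period \<open>m = 4 * t + 2\<close> forbids. If all residues were strictly
  below \<open>q * N\<close>, then from some index on every step would wrap around, and
  \<open>q ^ m\<close> would fix a residue that it must negate.\<close>

lemma bnorm_orbit: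
  assumes q: "q > 1" and nq: "n = q ^ m + 1" and m: "m = 4 * t + 2" and s: "(q\<^sup>2 + 1) * N = n"
    and e: "\<not> n dvd e"
    and b: "\<And>i. bnorm n (q ^ i * e) * (q ^ 4 * (q\<^sup>2 + 1)) < n * (q ^ 5 + (q - 1)\<^sup>2)"
  shows "\<And>i. bnorm n (q ^ i * e) \<le> q * N" "\<exists>i. bnorm n (q ^ i * e) = q * N"
proof -
  define r where "r i = bnorm n (q ^ i * e)" for i
  have n: "n > 0" unfolding nq using q by (simp add: add_pos_pos)
  have "0 < (q\<^sup>2 + 1) * N" using n s by simp
  then have N: "N > 0" by (rule zero_less_mult_pos) (simp add: add_nonneg_pos)
  have rr: "r (i + k) = bnorm n (q ^ k * r i)" for i k
    unfolding r_def bnorm_mult[OF n] by (simp add: power_add mult_ac)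
  have per: "r (i + m) = r i" for i
  proof -
    have "q ^ (i + m) * e + q ^ i * e = n * (q ^ i * e)"
      unfolding nq by (simp add: algebra_simps power_add)
    then show ?thesis unfolding r_def by (intro bnorm_cong[OF n]) auto
  qed
  have cop: "coprime n (q ^ k)" for k
  proof -
    have "coprime n q"
    proof (rule coprimeI)
      fix d assume "d dvd n" "d dvd q"
      moreover have "n - q * q ^ (m - 1) = 1" unfolding nq using m by (cases m) auto
      ultimately show "is_unit d" by (metis dvd_diff dvd_mult2)
    qed
    then show ?thesis by simp
  qed
  have pos: "r i > 0" for i
  proof -
    have "\<not> n dvd q ^ i * e" using cop e coprime_dvd_mult_right_iff by blast
    then show ?thesis unfolding r_def
      using bnorm_nonneg[OF n, of "q ^ i * e"] bnorm_eq_0_iff[OF n, of "q ^ i * e"] by linarith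
  qed
  have up: "r (i + 2) < q * N" "r (i + 4) > q * N" if "r i > q * N" for i
    using bnorm_step[OF n _ s N that] b[of i] q unfolding rr by (auto simp: r_def)
  have le: "r i \<le> q * N" for i
  proof (rule ccontr)
    assume "\<not> ?thesis"
    then have *: "r (i + 4 * k) > q * N" for k
    proof (induction k)
      case (Suc k)
      then show ?case using up(2)[of "i + 4 * k"] by (simp add: add.commute add.left_commute)
    qed simp
    \<comment> \<open>The first \<open>4 * t\<close> steps keep the residue above
      \<open>q * N\<close>, two more push it below, and together they make one full period.\<close>
    have "r (i + 4 * t + 2) < q * N" using up(1) * by blast
    moreover have "r (i + 4 * t + 2) = r i" using per[of i] by (simp add: m add.assoc)
    ultimately show False using *[of 0] by simp
  qed
  then show "\<And>i. bnorm n (q ^ i * e) \<le> q * N" by (simp add: r_def)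
  have h: "2 * (q * N) < n"
  proof -
    have "0 < (q - 1)\<^sup>2 * N" using N q by simp
    then show ?thesis unfolding s[symmetric] by (simp add: algebra_simps eval_nat_numeral)
  qed
  show "\<exists>i. bnorm n (q ^ i * e) = q * N"
  proof (rule ccontr)
    assume "\<nexists>i. bnorm n (q ^ i * e) = q * N"
    then have lt: "r i < q * N" for i using le[of i] by (auto simp: r_def less_le)
    \<comment> \<open>Without wrap-around every step multiplies by \<open>q\<close>, and a positive
      residue could not return after \<open>m\<close> steps.\<close>
    have big: "\<exists>i. n \<le> 2 * (q * r i)"
    proof (rule ccontr)
      assume "\<not> ?thesis"
      then have a: "2 * (q * r i) < n" for i by (simp add: not_le)
      have "r (i + 1) = q * r i" for i
        unfolding rr using a[of i] pos[of i] q n by (intro bnorm_eqI) auto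
      then have "r k = q ^ k * r 0" for k by (induction k) auto
      then have "r m = q ^ m * r 0" by blast
      moreover have "r m = r 0" using per[of 0] by simp
      ultimately have "q ^ m = 1" using pos[of 0] by simp
      then show False using one_less_power[OF q, of m] m by simp
    qed
    \<comment> \<open>A step that wraps leaves a residue of at least \<open>N\<close>; if the
      following step did not wrap, it would reach \<open>q * N\<close> or more. So wrapping, once
      begun, never stops.\<close>
    have nxt: "r (i + 1) = n - q * r i \<and> n \<le> 2 * (q * r (i + 1))" if "n \<le> 2 * (q * r i)" for i
    proof -
      have "q * r i \<le> q * (q * N)" using lt[of i] q by simp
      also have "\<dots> = n - N" unfolding s[symmetric] by (simp add: algebra_simps eval_nat_numeral)
      finally have *: "N \<le> n - q * r i" by simp
      have 1: "r (i + 1) = n - q * r i"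
        unfolding rr using that * N n by (intro bnorm_eqI) auto
      have "n \<le> 2 * (q * r (i + 1))"
      proof (rule ccontr)
        assume a: "\<not> ?thesis"
        then have "r ((i + 1) + 1) = q * r (i + 1)"
          unfolding rr[of "i + 1"] using pos[of "i + 1"] q n by (intro bnorm_eqI) auto
        moreover have "q * r (i + 1) \<ge> q * N" using 1 * q by simp
        ultimately show False using lt[of "(i + 1) + 1"] by simp
      qed
      with 1 show ?thesis by simp
    qed
    obtain i where i: "n \<le> 2 * (q * r i)" using big by blast
    have all: "n \<le> 2 * (q * r (i + k))" for k
    proof (induction k)
      case (Suc k)
      then show ?case using nxt[of "i + k"] by (metis add.assoc Suc_eq_plus1)
    qed (use i in simp)
    \<comment> \<open>Each wrap changes the sign. As \<open>m\<close> is even, the sign after one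
      period is positive, against \<open>q ^ m\<close> being \<open>-1\<close> modulo
      \<open>n\<close>.\<close>
    have "n dvd q ^ k * r i - (- 1) ^ k * r (i + k)" for k
    proof (induction k)
      case (Suc k)
      have "q ^ Suc k * r i - (- 1) ^ Suc k * r (i + Suc k)
          = q * (q ^ k * r i - (- 1) ^ k * r (i + k)) + (- 1) ^ k * n"
      proof -
        have eq: "r (i + Suc k) = n - q * r (i + k)" using nxt[OF all[of k]] by simp
        show ?thesis unfolding eq by (simp add: algebra_simps)
      qed
      then show ?case using Suc by simp
    qed simp
    moreover have "even m" using m by simp
    ultimately have "n dvd q ^ m * r i - r i" by (metis per power_minus_even power_one mult_1)
    moreover have "q ^ m * r i - r i = n * r i - 2 * r i" unfolding nq by (simp add: algebra_simps)
    ultimately have "n dvd 2 * r i" by (metis dvd_diff_right_iff dvd_triv_left)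
    then have "n \<le> 2 * r i" using pos[of i] by (intro zdvd_imp_le) auto
    then show False using lt[of i] h by simp
  qed
qed

lemma bnorm_le_abs:
  assumes "n > 0" "n dvd x - v \<or> n dvd x + v"
  shows "bnorm n x \<le> \<bar>v\<bar>"
proof (cases "2 * \<bar>v\<bar> \<le> n")
  case True
  then show ?thesis using bnorm_eq_abs[of n v x] assms by simp
next
  case False
  then show ?thesis using bnorm_le_half[of n x] by linarith
qed

text \<open>
  \<open>E\<close> is the least integer with \<open>n * (q ^ 5 + (q - 1)\<^sup>2) \<le> E * (q ^ 4 * (q\<^sup>2 + 1))\<close>, the lower bound
  for all residues beyond \<open>q * N\<close>; the first equation below shows the defect.
\<close>

lemma third_orbit:
  fixes q :: int
  assumes q: "q \<ge> 3" and Z: "Z = q ^ (4 * s)" and n: "n = q ^ 6 * Z + 1"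
    and N: "(q\<^sup>2 + 1) * N = n" and L: "(q\<^sup>2 + 1) * L = q\<^sup>2 * Z + 1"
    and E: "E = q * N + (q - 1)\<^sup>2 * L"
  shows "E * (q ^ 4 * (q\<^sup>2 + 1)) = n * (q ^ 5 + (q - 1)\<^sup>2) + (q - 1)\<^sup>2 * (q ^ 4 - 1)" (is ?exact)
    and "q * N < E" (is ?gt) and "2 * E < n" (is ?half)
    and "\<And>i. 0 < i \<Longrightarrow> i < 4 * s + 6 \<Longrightarrow> bnorm n (q ^ i * E) < E"
proof -
  have q1: "q\<^sup>2 + 1 > 0" by (simp add: add_nonneg_pos)
  have Z0: "Z > 0" using q unfolding Z by simp
  have n0: "n > 0" unfolding n using Z0 q by (simp add: add_pos_pos)
  have "0 < (q\<^sup>2 + 1) * L" unfolding L using Z0 q by (simp add: add_pos_pos)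
  then have L0: "L > 0" using q1 by (rule zero_less_mult_pos)
  \<comment> \<open>\<open>L\<close> is the analogue of \<open>N\<close> for the exponent
    \<open>4 * s + 2\<close>, while \<open>N\<close> belongs to \<open>4 * s + 6\<close>.\<close>
  have "(q\<^sup>2 + 1) * N = (q\<^sup>2 + 1) * (q ^ 4 * L - (q\<^sup>2 - 1))"
  proof -
    have "(q\<^sup>2 + 1) * (q ^ 4 * L - (q\<^sup>2 - 1)) = q ^ 4 * ((q\<^sup>2 + 1) * L) - (q ^ 4 - 1)"
      by (simp add: algebra_simps eval_nat_numeral)
    also have "\<dots> = n" unfolding L n by (simp add: algebra_simps eval_nat_numeral)
    finally show ?thesis using N by simp
  qed
  then have NL: "N = q ^ 4 * L - (q\<^sup>2 - 1)" using q1 by simp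
  \<comment> \<open>\<open>u\<close> is the excess of \<open>E\<close> over \<open>q * N\<close>,
    and \<open>c\<close> the amount by which \<open>q ^ 4 * u\<close> overshoots
    \<open>n - 2 * q * N = (q - 1) ^ 2 * N\<close>, the threshold in
    \<open>bnorm_step\<close>.\<close>
  define u where "u = (q - 1)\<^sup>2 * L"
  define c where "c = (q - 1)\<^sup>2 * (q\<^sup>2 - 1)"
  have u0: "u > 0" unfolding u_def using q L0 by simp
  have qq: "3 * q \<le> q\<^sup>2" unfolding power2_eq_square using q by simp
  then have q2: "q\<^sup>2 - 1 \<ge> q" "q\<^sup>2 \<ge> 9" using q by linarith+
  have c0: "c > 0" unfolding c_def using q q2 by simp
  have sq: "(q - 1)\<^sup>2 \<le> q\<^sup>2" using q by (intro power_mono) auto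
  have N2: "q\<^sup>2 * ((q\<^sup>2 - 1) * L) \<le> N"
  proof -
    have "q\<^sup>2 * 1 \<le> q\<^sup>2 * L" using L0 by (intro mult_left_mono) auto
    moreover have "q\<^sup>2 * ((q\<^sup>2 - 1) * L) = q ^ 4 * L - q\<^sup>2 * L"
      by (simp add: algebra_simps eval_nat_numeral)
    ultimately show ?thesis unfolding NL by linarith
  qed
  have N3: "q * (q\<^sup>2 * L) \<le> N"
  proof -
    have "q\<^sup>2 * (q * L) \<le> q\<^sup>2 * ((q\<^sup>2 - 1) * L)"
      using q2 L0 by (intro mult_left_mono mult_right_mono) auto
    then show ?thesis using N2 by (simp add: algebra_simps)
  qed
  have L1: "9 * L \<le> q\<^sup>2 * L" using q2 L0 by (intro mult_right_mono) auto
  have "3 * (q\<^sup>2 * L) \<le> q * (q\<^sup>2 * L)" using q L0 by (intro mult_right_mono) auto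
  then have NL27: "27 * L \<le> N" using N3 L1 by linarith
  then have N0: "N > 0" using L0 by linarith
  have qN: "3 * N \<le> q * N" using q N0 by simp
  have Eu: "E = q * N + u" unfolding E u_def ..
  show ?exact
  proof -
    have "E * (q ^ 4 * (q\<^sup>2 + 1)) = q ^ 5 * ((q\<^sup>2 + 1) * N) + (q - 1)\<^sup>2 * q ^ 4 * ((q\<^sup>2 + 1) * L)"
      unfolding E by (simp add: algebra_simps eval_nat_numeral)
    also have "\<dots> = n * (q ^ 5 + (q - 1)\<^sup>2) + (q - 1)\<^sup>2 * (q ^ 4 - 1)"
    proof -
      have "q ^ 4 * (q\<^sup>2 * Z + 1) = n + (q ^ 4 - 1)"
        unfolding n by (simp add: algebra_simps eval_nat_numeral)
      then have "(q - 1)\<^sup>2 * q ^ 4 * ((q\<^sup>2 + 1) * L) = (q - 1)\<^sup>2 * (n + (q ^ 4 - 1))"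
        unfolding L by (simp only: mult.assoc)
      then show ?thesis unfolding N by (simp add: distrib_left distrib_right mult.commute)
    qed
    finally show ?thesis .
  qed
  show ?gt unfolding Eu using u0 by simp
  show ?half
  proof -
    have "(q - 1)\<^sup>2 * (2 * L) < (q - 1)\<^sup>2 * N" using NL27 L0 q by (intro mult_strict_left_mono) auto
    then have "2 * u < (q - 1)\<^sup>2 * N" unfolding u_def by simp
    then show ?thesis unfolding Eu N[symmetric] by (simp add: algebra_simps power2_eq_square)
  qed
  have u4: "q ^ 4 * u = (q - 1)\<^sup>2 * N + c"
    unfolding u_def c_def NL by (simp add: algebra_simps)
  have cpt: "bnorm n x < E" if "n dvd x - v \<or> n dvd x + v" "\<bar>v\<bar> < E" for x v
    using bnorm_le_abs[OF n0 that(1)] that(2) by simp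
  \<comment> \<open>\<open>q * (Z * c)\<close> is the correction at the last index
    \<open>4 * s + 5\<close>, the largest one that occurs.\<close>
  have cZ: "N + q * (Z * c) < q * N"
  proof -
    have "q * (q - 1) * (q ^ 4 - 1) \<le> q * q * q ^ 4" using q by (intro mult_mono) auto
    then have "q * (q - 1) * (q ^ 4 - 1) * Z \<le> q * q * q ^ 4 * Z"
      using Z0 by (intro mult_right_mono) auto
    also have "\<dots> < n" unfolding n by (simp add: eval_nat_numeral mult_ac)
    finally have "(q - 1) * (q * (q - 1) * (q ^ 4 - 1) * Z) < (q - 1) * n"
      using q by (intro mult_strict_left_mono) auto
    then have "(q\<^sup>2 + 1) * (q * (Z * c)) < (q\<^sup>2 + 1) * ((q - 1) * N)"
      unfolding N[symmetric] c_def by (simp add: algebra_simps eval_nat_numeral)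
    then have "q * (Z * c) < (q - 1) * N" using q1 by simp
    then show ?thesis by (simp add: algebra_simps)
  qed
  have Zc: "Z * c \<le> q * (Z * c)" using q Z0 c0 by simp
  \<comment> \<open>Modulo \<open>n\<close>, \<open>q ^ 4 * E\<close> is
    \<open>- (q * N - c)\<close>; each further factor \<open>q ^ 2\<close> flips the sign of
    \<open>q * N\<close> and multiplies \<open>c\<close> by \<open>q ^ 2\<close>.\<close>
  have dv: "n dvd q ^ (4 + 2 * j) * E + ((- 1) ^ j * (q * N) - q ^ (2 * j) * c)" for j
  proof (induction j)
    case 0
    have "q ^ 4 * E + (q * N - c) = q ^ 4 * q * N + ((q - 1)\<^sup>2 * N + q * N)"
      unfolding Eu distrib_left u4 by simp
    also have "\<dots> = (q ^ 3 - q + 1) * n"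
      unfolding N[symmetric] by (simp add: algebra_simps eval_nat_numeral)
    finally show ?case by simp
  next
    case (Suc j)
    have "q ^ (4 + 2 * Suc j) * E + ((- 1) ^ Suc j * (q * N) - q ^ (2 * Suc j) * c)
      = q\<^sup>2 * (q ^ (4 + 2 * j) * E + ((- 1) ^ j * (q * N) - q ^ (2 * j) * c)) - (- 1) ^ j * q * n"
      unfolding N[symmetric] by (simp add: algebra_simps eval_nat_numeral)
    then show ?case using Suc by simp
  qed
  have w: "0 < q ^ (2 * j)" "q ^ (2 * j) * c \<le> Z * c" if "j \<le> 2 * s" for j
    using that q c0 unfolding Z by (auto intro!: mult_right_mono power_increasing)
  \<comment> \<open>For odd \<open>j\<close> the two terms of \<open>dv\<close> add up, so the
    correction has to stay below \<open>u\<close>. Parity gives \<open>j < 2 * s\<close> and thereby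
    a spare factor \<open>q ^ 2\<close>.\<close>
  have wo: "q ^ (2 * j) * c < u" if "j \<le> 2 * s" "odd j" for j
  proof -
    have "2 * j + 2 \<le> 4 * s" using that by presburger
    then have "q ^ (2 * j + 2) \<le> Z" unfolding Z using q by (intro power_increasing) auto
    then have "q\<^sup>2 * (q ^ (2 * j + 2)) \<le> q\<^sup>2 * Z" by (intro mult_left_mono) auto
    moreover have "q ^ (2 * j) > 0" using q by simp
    moreover have "(q\<^sup>2 + 1) * (q ^ (2 * j) * (q\<^sup>2 - 1)) = q\<^sup>2 * (q ^ (2 * j + 2)) - q ^ (2 * j)"
      by (simp add: algebra_simps eval_nat_numeral)
    ultimately have "(q\<^sup>2 + 1) * (q ^ (2 * j) * (q\<^sup>2 - 1)) < (q\<^sup>2 + 1) * L"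
      unfolding L by linarith
    then have "q ^ (2 * j) * (q\<^sup>2 - 1) < L" using q1 by simp
    then have "(q - 1)\<^sup>2 * (q ^ (2 * j) * (q\<^sup>2 - 1)) < (q - 1)\<^sup>2 * L"
      using q by (intro mult_strict_left_mono) auto
    then show ?thesis unfolding u_def c_def by (simp add: mult_ac)
  qed
  fix i :: nat assume i: "0 < i" "i < 4 * s + 6"
  consider "i = 1" | "i = 2" | "i = 3" | j where "i = 4 + 2 * j" "j \<le> 2 * s" | j where "i = 5 + 2 * j" "j \<le> 2 * s"
  proof -
    have "\<exists>j. i = 4 + 2 * j \<or> i = 5 + 2 * j" if "i \<ge> 4"
      by (rule exI[of _ "(i - 4) div 2"]) (use that in presburger)
    moreover have "i = 1 \<or> i = 2 \<or> i = 3 \<or> i \<ge> 4" using i by linarith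
    ultimately show ?thesis using that i by fastforce
  qed
  then show "bnorm n (q ^ i * E) < E"
  proof cases
    case 1
    have "q ^ i * E + (N - q * u) = n"
      unfolding 1 Eu N[symmetric] by (simp add: algebra_simps power2_eq_square)
    moreover have "\<bar>N - q * u\<bar> < E"
    proof -
      have "q * u \<le> q * (q\<^sup>2 * L)" unfolding u_def
        using q L0 sq by (intro mult_left_mono mult_right_mono) auto
      then have "q * u \<le> N" using N3 by simp
      moreover have "q * u > 0" using q u0 by simp
      ultimately show ?thesis unfolding Eu using qN u0 N0 by linarith
    qed
    ultimately show ?thesis by (intro cpt[of _ "N - q * u"]) auto
  next
    case 2
    have "q ^ i * E + (q * N - q\<^sup>2 * u) = q * n"
      unfolding 2 Eu N[symmetric] by (simp add: algebra_simps power2_eq_square)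
    moreover have "\<bar>q * N - q\<^sup>2 * u\<bar> < E"
    proof -
      have "q * (q * u) \<le> q * (q * (q\<^sup>2 * L))" unfolding u_def
        using q L0 sq by (intro mult_left_mono mult_right_mono) auto
      also have "\<dots> \<le> q * N" using N3 q by (intro mult_left_mono) auto
      finally have "q\<^sup>2 * u \<le> q * N" by (simp add: power2_eq_square mult.assoc)
      moreover have "q\<^sup>2 * u > 0" using q u0 by simp
      ultimately show ?thesis unfolding Eu using u0 by linarith
    qed
    ultimately show ?thesis by (intro cpt[of _ "q * N - q\<^sup>2 * u"]) auto
  next
    case 3
    have "q ^ i * E - (N + q ^ 3 * u) = (q\<^sup>2 - 1) * n"
      unfolding 3 Eu N[symmetric] by (simp add: algebra_simps eval_nat_numeral)
    \<comment> \<open>The comparison is made after multiplication by \<open>q\<close>, where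
      \<open>u4\<close> evaluates \<open>q ^ 4 * u\<close>; it reduces to
      \<open>c \<le> (q - 1) * N\<close>.\<close>
    moreover have "\<bar>N + q ^ 3 * u\<bar> < E"
    proof -
      have "(q - 1) * (q - 1) \<le> (q - 1) * q\<^sup>2" using q qq by (intro mult_left_mono) linarith+
      then have "(q - 1) * (q - 1) * (q\<^sup>2 - 1) \<le> (q - 1) * q\<^sup>2 * (q\<^sup>2 - 1)"
        using q2 q by (intro mult_right_mono) auto
      also have "\<dots> = (q - 1) * (q\<^sup>2 * ((q\<^sup>2 - 1) * 1))" by (simp add: mult_ac)
      also have "\<dots> \<le> (q - 1) * (q\<^sup>2 * ((q\<^sup>2 - 1) * L))"
        using q q2 L0 by (intro mult_left_mono) auto
      also have "\<dots> \<le> (q - 1) * N" using N2 q by (intro mult_left_mono) auto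
      finally have "c \<le> (q - 1) * N" unfolding c_def by (simp add: power2_eq_square mult_ac)
      moreover have "q * u > 0" using q u0 by simp
      ultimately have "q ^ 4 * u < (q - 1)\<^sup>2 * N + (q - 1) * N + q * u" unfolding u4 by linarith
      then have "q * (N + q ^ 3 * u) < q * E"
        unfolding Eu by (simp add: algebra_simps eval_nat_numeral)
      then have "N + q ^ 3 * u < E" using q by simp
      moreover have "q ^ 3 * u > 0" using q u0 by simp
      ultimately show ?thesis using N0 by linarith
    qed
    ultimately show ?thesis by (intro cpt[of _ "N + q ^ 3 * u"]) auto
  next
    case (4 j)
    have "\<bar>(- 1) ^ j * (q * N) - q ^ (2 * j) * c\<bar> < E"
    proof -
      have p: "0 < q ^ (2 * j) * c" using q c0 by simp
      show ?thesis
      proof (cases "even j")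
        case True
        then show ?thesis unfolding Eu using w(2)[OF 4(2)] p u0 Zc cZ N0 qN by simp
      next
        case False
        have "\<bar>- (q * N) - q ^ (2 * j) * c\<bar> < q * N + u"
          using wo[OF 4(2) False] p N0 qN by linarith
        then show ?thesis unfolding Eu using False by simp
      qed
    qed
    then show ?thesis using dv[of j] unfolding 4(1) by (intro cpt) auto
  next
    case (5 j)
    let ?v = "(- 1) ^ j * N + q * (q ^ (2 * j) * c)"
    have "q ^ i * E - ?v = q * (q ^ (4 + 2 * j) * E + ((- 1) ^ j * (q * N) - q ^ (2 * j) * c)) - (- 1) ^ j * n"
      unfolding 5(1) N[symmetric] by (simp add: algebra_simps eval_nat_numeral)
    then have "n dvd q ^ i * E - ?v" using dv[of j] by (metis dvd_diff dvd_mult dvd_refl)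
    moreover have "\<bar>?v\<bar> < E"
    proof -
      have p: "0 < q * (q ^ (2 * j) * c)" using q c0 by simp
      have "q * (q ^ (2 * j) * c) \<le> q * (Z * c)"
        using w(2)[OF 5(2)] q by (intro mult_left_mono) auto
      then show ?thesis unfolding Eu using p u0 cZ N0 by (cases "even j") auto
    qed
    ultimately show ?thesis by (intro cpt) auto
  qed
qed

section \<open>Cyclotomic cosets and their leaders\<close>

locale coprime_length =
  fixes q n :: nat
  assumes n_gt_1: "n > 1" and coprime_n_q: "coprime n q"
begin

lemma ord_pos: "ord n q > 0"
  using coprime_n_q by (simp add: coprime_commute)

lemma cong_mult_period: "[s * q ^ (i + ord n q * k) = s * q ^ i] (mod n)"
proof -
  have "[q ^ (ord n q * k) = 1] (mod n)" unfolding ord_divides by simp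
  then have "[s * q ^ i * q ^ (ord n q * k) = s * q ^ i * 1] (mod n)" by (rule cong_scalar_left)
  then show ?thesis by (simp add: power_add mult.assoc)
qed

lemma cyc_coset_eq: "cyc_coset q n s = range (\<lambda>i. s * q ^ i mod n)"
proof -
  have "\<exists>j < ord n q. s * q ^ i mod n = s * q ^ j mod n" for i
  proof (intro exI conjI)
    show "i mod ord n q < ord n q" using ord_pos by simp
    show "s * q ^ i mod n = s * q ^ (i mod ord n q) mod n"
      using cong_mult_period[of s "i mod ord n q" "i div ord n q"]
      by (simp add: unique_euclidean_semiring_class.cong_def)
  qed
  then show ?thesis unfolding cyc_coset_def by fast
qed

lemma finite_cyc_coset: "finite (cyc_coset q n s)"
  unfolding cyc_coset_def by simp

lemma cyc_coset_less: "x \<in> cyc_coset q n s \<Longrightarrow> x < n"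
  unfolding cyc_coset_def using n_gt_1 by auto

lemma self_in_cyc_coset: "s < n \<Longrightarrow> s \<in> cyc_coset q n s"
  unfolding cyc_coset_eq by (rule range_eqI[of _ _ 0]) simp

lemma cyc_coset_step: "x \<in> cyc_coset q n s \<Longrightarrow> x * q ^ i mod n \<in> cyc_coset q n s"
  unfolding cyc_coset_eq by (auto simp: mod_mult_left_eq mult.assoc simp flip: power_add)

lemma cyc_coset_subset: "x \<in> cyc_coset q n s \<Longrightarrow> cyc_coset q n x \<subseteq> cyc_coset q n s"
  using cyc_coset_step unfolding cyc_coset_eq[of x] by auto

lemma cyc_coset_sym:
  assumes "x \<in> cyc_coset q n s" "s < n" shows "s \<in> cyc_coset q n x"
proof -
  obtain i where i: "i < ord n q" "x = s * q ^ i mod n"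
    using assms unfolding cyc_coset_def by auto
  have "x * q ^ (ord n q - i) mod n = s * q ^ (i + (ord n q - i)) mod n"
    unfolding i by (simp add: mod_mult_left_eq mult.assoc flip: power_add)
  also have "\<dots> = s" using cong_mult_period[of s 0 1] i assms(2)
    by (simp add: unique_euclidean_semiring_class.cong_def)
  finally show ?thesis unfolding cyc_coset_eq by (metis rangeI)
qed

lemma cyc_coset_cong: "x \<in> cyc_coset q n s \<Longrightarrow> s < n \<Longrightarrow> cyc_coset q n x = cyc_coset q n s"
  by (meson cyc_coset_less cyc_coset_subset cyc_coset_sym subset_antisym)

lemma MinRep_iff: "s \<in> MinRep q n \<longleftrightarrow> s < n \<and> (\<forall>i. s \<le> s * q ^ i mod n)"
proof -
  have "s = Min (cyc_coset q n s) \<longleftrightarrow> (\<forall>x \<in> cyc_coset q n s. s \<le> x)" if "s < n"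
    using that self_in_cyc_coset[OF that] finite_cyc_coset
    by (metis Min_eqI Min_le)
  then show ?thesis unfolding MinRep_def cyc_coset_eq by auto
qed

lemma finite_MinRep: "finite (MinRep q n)"
  unfolding MinRep_def by simp

lemma Min_cyc_coset:
  assumes "j < n"
  shows "Min (cyc_coset q n j) \<in> MinRep q n" "j \<in> cyc_coset q n (Min (cyc_coset q n j))"
proof -
  have *: "Min (cyc_coset q n j) \<in> cyc_coset q n j"
    using Min_in finite_cyc_coset self_in_cyc_coset[OF assms] by blast
  then show "j \<in> cyc_coset q n (Min (cyc_coset q n j))" using cyc_coset_sym assms by blast
  show "Min (cyc_coset q n j) \<in> MinRep q n"
    unfolding MinRep_def using cyc_coset_cong[OF * assms] cyc_coset_less[OF *] by simp
qed

lemma MinRep_unique: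
  assumes "a \<in> MinRep q n" "b \<in> MinRep q n" "j \<in> cyc_coset q n a" "j \<in> cyc_coset q n b"
  shows "a = b"
  using assms cyc_coset_cong unfolding MinRep_def by (metis (mono_tags, lifting) mem_Collect_eq)

lemma zero_in_cyc_coset_iff: "0 \<in> cyc_coset q n s \<longleftrightarrow> n dvd s"
proof -
  have "s * q ^ i mod n = 0 \<longleftrightarrow> n dvd s" for i
    using coprime_n_q by (simp add: coprime_dvd_mult_left_iff flip: dvd_eq_mod_eq_0)
  then show ?thesis unfolding cyc_coset_eq image_iff by (metis UNIV_I)
qed

lemma cyc_coset_0: "cyc_coset q n 0 = {0}"
  unfolding cyc_coset_eq by auto

text \<open>The exact period \<open>k\<close> counts the coset: the first \<open>k\<close> multiples
  exhaust it, and cancelling a power of \<open>q\<close> shows them distinct.\<close>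

lemma card_cyc_coset:
  assumes k: "k > 0" "[s * q ^ k = s] (mod n)"
    and min: "\<And>i. 0 < i \<Longrightarrow> i < k \<Longrightarrow> \<not> [s * q ^ i = s] (mod n)"
  shows "card (cyc_coset q n s) = k"
proof -
  have per: "[s * q ^ (i + k * j) = s * q ^ i] (mod n)" for i j
  proof (induction j)
    case (Suc j)
    have "[s * q ^ k * q ^ (i + k * j) = s * q ^ (i + k * j)] (mod n)"
      by (rule cong_scalar_right[OF k(2)])
    moreover have "s * q ^ k * q ^ (i + k * j) = s * q ^ (i + k * Suc j)"
      by (simp add: power_add mult_ac)
    ultimately show ?case using Suc by (metis cong_trans)
  qed simp
  have "cyc_coset q n s = (\<lambda>i. s * q ^ i mod n) ` {..<k}"
  proof -
    have "s * q ^ i mod n = s * q ^ (i mod k) mod n" for i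
      using per[of "i mod k" "i div k"] by (simp add: unique_euclidean_semiring_class.cong_def)
    moreover have "i mod k < k" for i using k by simp
    ultimately show ?thesis unfolding cyc_coset_eq by (auto simp: image_iff)
  qed
  moreover have "inj_on (\<lambda>i. s * q ^ i mod n) {..<k}"
  proof (rule linorder_inj_onI)
    fix i j assume ij: "i < j" "i \<in> {..<k}" "j \<in> {..<k}"
    show "s * q ^ i mod n \<noteq> s * q ^ j mod n"
    proof
      assume "s * q ^ i mod n = s * q ^ j mod n"
      then have "[s * q ^ (j - i) * q ^ i = s * q ^ i] (mod n)"
        using ij by (simp add: unique_euclidean_semiring_class.cong_def mult.assoc flip: power_add)
      moreover have "coprime (q ^ i) n" using coprime_n_q by (simp add: coprime_commute)
      ultimately have "[s * q ^ (j - i) = s] (mod n)" using cong_mult_rcancel_nat by blast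
      then show False using min[of "j - i"] ij by (auto simp: less_imp_diff_less)
    qed
  qed auto
  ultimately show ?thesis by (simp add: card_image)
qed

text \<open>The defining set of the code: the exponents of those powers of \<open>\<beta>\<close>
  that are roots of the generator polynomial.\<close>

definition zeros :: "nat \<Rightarrow> nat \<Rightarrow> nat set" where
  "zeros b e = (\<Union>i\<in>{b..e}. cyc_coset q n i)"

text \<open>A coset meets \<open>{b..e}\<close> exactly when its leader lies there: a leader is at
  most every member, and for \<open>b = 1\<close> the leader \<open>0\<close> has the coset
  \<open>{0}\<close> alone. So the leaders outside the interval partition the exponents outside
  \<open>zeros b e\<close>.\<close>

lemma card_compl_zeros:
  assumes "b \<le> 1" "e < n"
  shows "n - card (zeros b e) = (\<Sum>a | a \<in> MinRep q n \<and> (a < b \<or> e < a). card (cyc_coset q n a))"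
proof -
  let ?A = "{a \<in> MinRep q n. a < b \<or> e < a}"
  have iff: "j \<in> zeros b e \<longleftrightarrow> b \<le> Min (cyc_coset q n j) \<and> Min (cyc_coset q n j) \<le> e" if j: "j < n" for j
  proof
    assume "j \<in> zeros b e"
    then obtain i where i: "b \<le> i" "i \<le> e" "j \<in> cyc_coset q n i" unfolding zeros_def by auto
    have eq: "cyc_coset q n j = cyc_coset q n i" using cyc_coset_cong i assms by simp
    have self: "i \<in> cyc_coset q n i" using self_in_cyc_coset i assms by simp
    have "Min (cyc_coset q n i) \<noteq> 0" if "b = 1"
    proof
      assume "Min (cyc_coset q n i) = 0"
      then have "0 \<in> cyc_coset q n i" using Min_in[OF finite_cyc_coset] self by fastforce
      then have "n dvd i" by (simp add: zero_in_cyc_coset_iff)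
      then show False using i assms that by (auto dest: dvd_imp_le)
    qed
    moreover have "Min (cyc_coset q n i) \<le> i" using Min_le[OF finite_cyc_coset self] .
    ultimately show "b \<le> Min (cyc_coset q n j) \<and> Min (cyc_coset q n j) \<le> e"
      unfolding eq using i assms by (cases "b = 1") auto
  next
    assume "b \<le> Min (cyc_coset q n j) \<and> Min (cyc_coset q n j) \<le> e"
    then show "j \<in> zeros b e" unfolding zeros_def using Min_cyc_coset(2)[OF j] by auto
  qed
  have "{..<n} - zeros b e = (\<Union>a\<in>?A. cyc_coset q n a)"
  proof (intro equalityI subsetI)
    fix j assume "j \<in> {..<n} - zeros b e"
    then have "Min (cyc_coset q n j) \<in> ?A" "j \<in> cyc_coset q n (Min (cyc_coset q n j))"
      using iff[of j] Min_cyc_coset[of j] by auto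
    then show "j \<in> (\<Union>a\<in>?A. cyc_coset q n a)" by blast
  next
    fix j assume "j \<in> (\<Union>a\<in>?A. cyc_coset q n a)"
    then obtain a where a: "a \<in> ?A" "j \<in> cyc_coset q n a" by blast
    have j: "j < n" using a cyc_coset_less by blast
    have "a = Min (cyc_coset q n j)"
      using a MinRep_unique Min_cyc_coset[OF j] by blast
    then show "j \<in> {..<n} - zeros b e" using iff[OF j] a j by auto
  qed
  moreover have "card (\<Union>a\<in>?A. cyc_coset q n a) = (\<Sum>a\<in>?A. card (cyc_coset q n a))"
    by (rule card_UN_disjoint) (use finite_MinRep finite_cyc_coset MinRep_unique in auto)
  moreover have "zeros b e \<subseteq> {..<n}" unfolding zeros_def using cyc_coset_less by auto
  moreover from this have "finite (zeros b e)" using finite_subset by blast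
  ultimately show ?thesis using card_Diff_subset[of "zeros b e" "{..<n}"] by auto
qed

end

text \<open>Trades the list access in \<open>delta_leader\<close> for order facts.\<close>

lemma top_four_rev_sorted_list:
  fixes A :: "nat set"
  assumes "finite A" "card A \<ge> 4"
  defines "d i \<equiv> rev (sorted_list_of_set A) ! (i - 1)"
  shows "d 1 \<in> A" "d 2 \<in> A" "d 3 \<in> A" "d 4 \<in> A" "d 4 < d 3" "d 3 < d 2" "d 2 < d 1"
    and "\<And>a. a \<in> A \<Longrightarrow> a \<in> {d 1, d 2, d 3} \<or> a \<le> d 4"
proof -
  let ?xs = "rev (sorted_list_of_set A)"
  have len: "length ?xs \<ge> 4" using assms by simp
  have set: "set ?xs = A" using assms by simp
  have dec: "?xs ! j < ?xs ! i" if "i < j" "j < length ?xs" for i j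
  proof -
    have "sorted_wrt (<) (sorted_list_of_set A)" by simp
    then have "sorted_wrt (>) ?xs" by (simp add: sorted_wrt_rev)
    then show ?thesis using that sorted_wrt_nth_less by blast
  qed
  show "d 1 \<in> A" "d 2 \<in> A" "d 3 \<in> A" "d 4 \<in> A"
    using nth_mem[of _ ?xs] len unfolding set d_def by auto
  show "d 4 < d 3" "d 3 < d 2" "d 2 < d 1" unfolding d_def using len by (auto intro!: dec)
  fix a assume "a \<in> A"
  then obtain i where i: "i < length ?xs" "a = ?xs ! i" by (metis set in_set_conv_nth)
  consider "i = 0" | "i = 1" | "i = 2" | "i = 3" | "i > 3" by linarith
  then show "a \<in> {d 1, d 2, d 3} \<or> a \<le> d 4"
    by cases (use i dec[of 3 i] in \<open>auto simp: d_def\<close>)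
qed

section \<open>The largest leaders modulo \<open>q ^ m + 1\<close>\<close>

text \<open>Facts for an arbitrary positive \<open>m\<close>; \<open>bch_length\<close> adds that
  \<open>m\<close> is 2 modulo 4.\<close>

locale antipodal_length =
  fixes q m n h :: nat
  assumes odd_q: "odd q" and q_ge_3: "q \<ge> 3" and m_pos: "m > 0"
    and n_eq: "n = q ^ m + 1" and n_eq_2h: "n = 2 * h"
begin

sublocale coprime_length q n
proof
  show "n > 1" unfolding n_eq using q_ge_3 by simp
  have "coprime (q ^ m + 1) (q ^ m)" by (rule coprime_add_one_left)
  then show "coprime n q" unfolding n_eq using m_pos by simp
qed

lemma h_pos: "h > 0"
  using n_eq_2h n_gt_1 by simp

text \<open>The order divides \<open>2 * m\<close> because \<open>q ^ m\<close> is
  \<open>-1\<close>, and it exceeds \<open>m\<close> because the powers up to \<open>q ^ m\<close>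
  are smaller than \<open>n\<close> and cannot wrap around to 1.\<close>

lemma ord_n_q: "ord n q = 2 * m"
proof -
  have "[q ^ (2 * m) = 1] (mod n)"
  proof -
    have "int (q ^ (2 * m)) - 1 = int n * (int q ^ m - 1)"
      unfolding n_eq by (simp add: algebra_simps power_mult power2_eq_square)
    then show ?thesis unfolding cong_int_iff[symmetric] cong_iff_dvd_diff by simp
  qed
  then have "ord n q dvd 2 * m" unfolding ord_divides .
  then obtain c where c: "2 * m = ord n q * c" by blast
  have "ord n q > m"
  proof (rule ccontr)
    assume "\<not> ?thesis"
    then have "q ^ ord n q \<le> q ^ m" using q_ge_3 by (intro power_increasing) auto
    then have "q ^ ord n q < n" unfolding n_eq by simp
    moreover have "[q ^ ord n q = 1] (mod n)" by (rule ord)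
    ultimately have "q ^ ord n q = 1" using n_gt_1 by (metis cong_def mod_less)
    then show False using ord_pos q_ge_3 by simp
  qed
  then have "ord n q * c < ord n q * 2" using c by linarith
  then have "c = 1" using c m_pos by (cases c) auto
  then show ?thesis using c by simp
qed

lemma antipode:
  assumes "x > 0" "x < n" shows "x * q ^ m mod n = n - x"
proof -
  have "x * q ^ m + x = n * x" unfolding n_eq by (simp add: algebra_simps)
  then have "n dvd x * q ^ m + x" by simp
  then have "[x * q ^ m + x = (n - x) + x] (mod n)" using assms by (simp add: cong_def)
  then have "[x * q ^ m = n - x] (mod n)" by (simp add: cong_add_rcancel_nat)
  then show ?thesis using assms by (simp add: cong_def)
qed

text \<open>As \<open>q ^ i\<close> is odd, \<open>q ^ i * h\<close> is congruent to
  \<open>h\<close> modulo \<open>2 * h\<close>. Hence \<open>h - s\<close> is sent to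
  \<open>h - s * q ^ i\<close>, and reducing the product modulo \<open>n\<close> makes this
  difference balanced.\<close>

lemma bnorm_orbit_eq:
  assumes "s \<le> h"
  shows "bnorm (int n) (int q ^ i * int (h - s)) = \<bar>int h - int (s * q ^ i mod n)\<bar>"
proof -
  let ?x = "s * q ^ i mod n"
  have "2 * \<bar>int h - int x\<bar> \<le> int n" if "x < n" for x using that unfolding n_eq_2h by (auto simp: abs_if)
  then have b: "2 * \<bar>int h - int ?x\<bar> \<le> int n" using n_gt_1 by simp
  obtain k where k: "q ^ i = 2 * k + 1" using odd_q by (metis even_power oddE)
  have "int q ^ i * int h - int h = int n * int k"
  proof -
    have "int q ^ i = 2 * int k + 1" using k by (metis of_nat_1 of_nat_add of_nat_mult of_nat_numeral of_nat_power)
    then show ?thesis unfolding n_eq_2h by (simp add: algebra_simps)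
  qed
  moreover have "int n dvd int (s * q ^ i) - int ?x" by (simp add: zmod_int minus_mod_eq_mult_div)
  moreover have "int q ^ i * int (h - s) - (int h - int ?x)
     = (int q ^ i * int h - int h) - (int (s * q ^ i) - int ?x)"
    using assms by (simp add: algebra_simps of_nat_diff)
  ultimately have "int n dvd int q ^ i * int (h - s) - (int h - int ?x)"
    by (metis dvd_diff dvd_triv_left)
  then show ?thesis using b n_gt_1 by (intro bnorm_eq_abs) linarith+
qed

text \<open>Multiplication by \<^term>\<open>q ^ m\<close> is negation, so a coset leader measures how far its orbit strays
  from the midpoint \<^term>\<open>h\<close>.\<close>

lemma MinRep_iff_bnorm:
  "s \<in> MinRep q n \<longleftrightarrow> s \<le> h \<and> (\<forall>i. bnorm (int n) (int q ^ i * int (h - s)) \<le> int (h - s))"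
proof (cases "s \<le> h")
  case True
  then have s: "s < n" using n_eq_2h h_pos by simp
  have "(\<forall>i. s \<le> s * q ^ i mod n) \<longleftrightarrow> (\<forall>i. \<bar>int h - int (s * q ^ i mod n)\<bar> \<le> int (h - s))"
  proof safe
    fix i assume a: "\<forall>i. s \<le> s * q ^ i mod n"
    let ?x = "s * q ^ i mod n"
    \<comment> \<open>Unless \<open>?x\<close> is 0, the coset also contains \<open>n - ?x\<close>,
      so minimality of \<open>s\<close> bounds \<open>?x\<close> from above as well.\<close>
    have "s + ?x \<le> n"
    proof (cases "?x = 0")
      case False
      have "?x < n" using n_gt_1 by simp
      then have "?x * q ^ m mod n = n - ?x" using antipode False by simp
      moreover have "?x * q ^ m mod n = s * q ^ (i + m) mod n"
        by (simp add: mod_mult_left_eq power_add mult.assoc)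
      ultimately have "s \<le> n - ?x" using a by metis
      then show ?thesis using \<open>?x < n\<close> by simp
    qed (use s in simp)
    moreover have "\<bar>int h - int x\<bar> \<le> int (h - s)" if "s + x \<le> n" "s \<le> x" for x
      using that True unfolding n_eq_2h by (auto simp: abs_if)
    ultimately show "\<bar>int h - int ?x\<bar> \<le> int (h - s)" using a by blast
  next
    fix i assume "\<forall>i. \<bar>int h - int (s * q ^ i mod n)\<bar> \<le> int (h - s)"
    then have "\<bar>int h - int (s * q ^ i mod n)\<bar> \<le> int (h - s)" by blast
    then show "s \<le> s * q ^ i mod n" using True by linarith
  qed
  then show ?thesis using True s by (simp add: MinRep_iff bnorm_orbit_eq del: of_nat_diff_if of_nat_diff)
next
  case False
  \<comment> \<open>A leader cannot exceed \<open>h\<close>, since its antipode \<open>n - s\<close>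
    would be a smaller member of the coset.\<close>
  then have "s > 0" "s < n \<Longrightarrow> n - s < s" using n_eq_2h by auto
  then show ?thesis using False antipode[of s] unfolding MinRep_iff by (metis not_le)
qed

lemma cong_orbit_iff:
  assumes "s \<le> h"
  shows "[s * q ^ i = s] (mod n) \<longleftrightarrow> int n dvd int q ^ i * int (h - s) - int (h - s)"
proof -
  obtain k where k: "q ^ i = 2 * k + 1" using odd_q by (metis even_power oddE)
  have k: "int q ^ i = 2 * int k + 1" using k by (metis of_nat_1 of_nat_add of_nat_mult of_nat_numeral of_nat_power)
  have "int q ^ i * int (h - s) - int (h - s) = int n * int k - (int s * int q ^ i - int s)"
    unfolding k using assms by (simp add: n_eq_2h algebra_simps of_nat_diff)
  then have "int n dvd int q ^ i * int (h - s) - int (h - s) \<longleftrightarrow> int n dvd int s * int q ^ i - int s"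
    by (metis dvd_diff_right_iff dvd_triv_left)
  then show ?thesis by (simp add: cong_iff_dvd_diff flip: cong_int_iff)
qed

lemma h_MinRep: "h \<in> MinRep q n"
  unfolding MinRep_iff_bnorm by (simp add: bnorm_def)

lemma zero_MinRep: "0 \<in> MinRep q n"
  unfolding MinRep_iff using n_gt_1 by simp

text \<open>Serves to guarantee four distinct leaders, so that \<open>delta_leader q n 4\<close> is
  a genuine one.\<close>

lemma one_MinRep: "1 \<in> MinRep q n"
proof -
  have "0 \<notin> cyc_coset q n 1" using zero_in_cyc_coset_iff n_gt_1 by simp
  then have "1 * q ^ i mod n \<noteq> 0" for i unfolding cyc_coset_eq by (metis rangeI)
  then show ?thesis unfolding MinRep_iff using n_gt_1 by (simp add: Suc_le_eq)
qed

lemma card_cyc_coset_h: "card (cyc_coset q n h) = 1"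
proof (rule card_cyc_coset)
  show "[h * q ^ 1 = h] (mod n)" unfolding cong_orbit_iff[OF order.refl] by simp
  show "\<not> [h * q ^ i = h] (mod n)" if "0 < i" "i < 1" for i using that by simp
qed simp

lemma bnorm_period: "bnorm (int n) (int q ^ (i + m * k) * e) = bnorm (int n) (int q ^ i * e)"
proof (induction k)
  case (Suc k)
  have "int q ^ (i + m * Suc k) * e + int q ^ (i + m * k) * e = int n * (int q ^ (i + m * k) * e)"
    unfolding n_eq by (simp add: power_add algebra_simps)
  then have "bnorm (int n) (int q ^ (i + m * Suc k) * e) = bnorm (int n) (int q ^ (i + m * k) * e)"
    using n_gt_1 by (intro bnorm_cong) auto
  then show ?case using Suc by simp
qed simp

text \<open>A return to \<open>s\<close> after \<open>i\<close> steps makes the residue at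
  \<open>i\<close> equal to \<open>h - s\<close>. Strictness excludes this for
  \<open>0 < i < m\<close>, the sign excludes \<open>i = m\<close>, and beyond \<open>m\<close> the
  residues repeat.\<close>

lemma card_cyc_coset_bnorm:
  assumes s: "0 < s" "s < h"
    and lt: "\<And>i. 0 < i \<Longrightarrow> i < m \<Longrightarrow> bnorm (int n) (int q ^ i * int (h - s)) < int (h - s)"
  shows "card (cyc_coset q n s) = 2 * m"
proof (rule card_cyc_coset)
  define e where "e = int (h - s)"
  have e: "0 < e" "2 * e < int n" "s \<le> h" using s n_eq_2h by (auto simp: e_def)
  have qm: "int q ^ m = int n - 1" unfolding n_eq by simp
  show "2 * m > 0" using m_pos by simp
  show "[s * q ^ (2 * m) = s] (mod n)"
    using cong_mult_period[of s 0 1] by (simp add: ord_n_q)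
  fix i assume i: "0 < i" "i < 2 * m"
  show "\<not> [s * q ^ i = s] (mod n)"
  proof
    assume "[s * q ^ i = s] (mod n)"
    then have d: "int n dvd int q ^ i * e - e" using cong_orbit_iff e by (simp add: e_def)
    have eq: "bnorm (int n) (int q ^ i * e) = e"
      using d e by (intro bnorm_eqI) auto
    consider "i < m" | "i = m" | k where "i = m + k" "0 < k" "k < m"
    proof -
      have "i < m \<or> i = m \<or> (i = m + (i - m) \<and> 0 < i - m \<and> i - m < m)" using i by linarith
      then show ?thesis using that by blast
    qed
    then show False
    proof cases
      case 1
      then show False using lt[of i] i eq by (simp add: e_def)
    next
      case 2
      have "int q ^ i * e - e = int n * e - 2 * e" unfolding 2 qm by (simp add: algebra_simps)
      then have "int n dvd 2 * e" using d by (metis dvd_diff_right_iff dvd_triv_left)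
      then have "int n \<le> 2 * e" using e by (intro zdvd_imp_le) auto
      then show False using e by simp
    next
      case (3 k)
      have "int q ^ i * e + int q ^ k * e = int n * (int q ^ k * e)"
        unfolding 3 power_add qm by (simp add: algebra_simps)
      then have "bnorm (int n) (int q ^ i * e) = bnorm (int n) (int q ^ k * e)"
        using n_gt_1 by (intro bnorm_cong) auto
      then show False using lt[of k] 3 eq by (simp add: e_def)
    qed
  qed
qed

end

section \<open>The two largest leaders\<close>

locale bch_length = antipodal_length +
  fixes t :: nat and N :: int
  assumes m_eq: "m = 4 * t + 2" and N_eq: "((int q)\<^sup>2 + 1) * N = int n"
begin

lemma N_pos: "N > 0"
proof -
  have "0 < ((int q)\<^sup>2 + 1) * N" unfolding N_eq using n_gt_1 by simp
  then show ?thesis by (rule zero_less_mult_pos) (simp add: add_nonneg_pos)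
qed

lemma qN_pos: "0 < int q * N"
  using N_pos q_ge_3 by (intro mult_pos_pos) auto

lemma qN_less_half: "2 * (int q * N) < int n"
proof -
  have "0 < (int q - 1)\<^sup>2 * N" using N_pos q_ge_3 by simp
  then show ?thesis unfolding N_eq[symmetric] by (simp add: algebra_simps power2_eq_square)
qed

text \<open>The residue \<open>e\<close> of a leader is the largest in its orbit, so a bound on
  \<open>e\<close> bounds the whole orbit. Then \<open>bnorm_orbit\<close> shows that
  \<open>q * N\<close> occurs in the orbit and is also an upper bound for it.\<close>

lemma leader_dichotomy:
  assumes "s \<in> MinRep q n" "s \<noteq> h"
  defines "e \<equiv> int h - int s"
  shows "e = int q * N \<or> int n * (int q ^ 5 + (int q - 1)\<^sup>2) \<le> e * (int q ^ 4 * ((int q)\<^sup>2 + 1))"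
proof (rule disjCI)
  assume "\<not> int n * (int q ^ 5 + (int q - 1)\<^sup>2) \<le> e * (int q ^ 4 * ((int q)\<^sup>2 + 1))"
  then have a: "e * (int q ^ 4 * ((int q)\<^sup>2 + 1)) < int n * (int q ^ 5 + (int q - 1)\<^sup>2)" by simp
  have s: "s < h" using assms MinRep_iff_bnorm by simp
  have e: "e = int (h - s)" "e > 0" using s by (auto simp: e_def)
  have le: "bnorm (int n) (int q ^ i * e) \<le> e" for i
    using assms(1) unfolding MinRep_iff_bnorm e by blast
  have e2: "2 * e \<le> int n" using n_eq_2h by (simp add: e_def)
  have K: "int q ^ 4 * ((int q)\<^sup>2 + 1) \<ge> 0" by simp
  have b: "bnorm (int n) (int q ^ i * e) * (int q ^ 4 * ((int q)\<^sup>2 + 1)) < int n * (int q ^ 5 + (int q - 1)\<^sup>2)" for i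
    using mult_right_mono[OF le K] a by (rule le_less_trans)
  have "\<not> int n dvd e"
  proof
    assume "int n dvd e"
    then have "int n \<le> e" using e by (intro zdvd_imp_le) auto
    then show False using e e2 by simp
  qed
  note orb = bnorm_orbit[of "int q" "int n" m t N e, OF _ _ m_eq N_eq this b]
  have "bnorm (int n) (int q ^ 0 * e) = e" using e e2 by (intro bnorm_eqI) auto
  then have "e \<le> int q * N" using orb(1)[of 0] q_ge_3 n_eq by simp
  moreover obtain i where "bnorm (int n) (int q ^ i * e) = int q * N"
    using orb(2) q_ge_3 n_eq by auto
  ultimately show "e = int q * N" using le[of i] by simp
qed

text \<open>For \<open>e = q * N\<close> the right-hand side of the bound is only
  \<open>n * q ^ 5\<close>.\<close>

lemma bound_gt:
  assumes "int n * (int q ^ 5 + (int q - 1)\<^sup>2) \<le> e * (int q ^ 4 * ((int q)\<^sup>2 + 1))"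
  shows "e > int q * N"
proof -
  let ?K = "int q ^ 4 * ((int q)\<^sup>2 + 1)"
  have "int q * N * ?K = int n * int q ^ 5" unfolding N_eq[symmetric] by (simp add: algebra_simps eval_nat_numeral)
  also have "\<dots> < int n * (int q ^ 5 + (int q - 1)\<^sup>2)" using n_gt_1 q_ge_3 by simp
  also note assms
  finally show ?thesis by (rule mult_right_less_imp_less) simp
qed

definition second :: nat where "second = h - q * nat N"

lemma second_eq: "int h - int second = int q * N" "second < h" "second > 1"
proof -
  have qN: "int (q * nat N) = int q * N" using N_pos by simp
  have "q * nat N \<le> h" unfolding of_nat_le_iff[where ?'a = int, symmetric] qN
    using qN_less_half n_eq_2h by simp
  then show 1: "int h - int second = int q * N" unfolding second_def qN[symmetric] by simp
  then show "second < h" using qN_pos by linarith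
  \<comment> \<open>\<open>2 * second\<close> equals \<open>(q - 1) ^ 2 * N\<close>, which is at
    least \<open>4 * N\<close>. The bound \<open>second > 1\<close> separates it from the leaders
    \<open>0\<close> and \<open>1\<close>.\<close>
  have "(int q - 1)\<^sup>2 \<ge> 2\<^sup>2" using q_ge_3 by (intro power_mono) auto
  then have "4 * N \<le> (int q - 1)\<^sup>2 * N" using N_pos by (intro mult_right_mono) auto
  also have "\<dots> = 2 * int second" 
  proof -
    have "2 * int h = ((int q)\<^sup>2 + 1) * N" using N_eq n_eq_2h by simp
    then show ?thesis using 1 by (simp add: algebra_simps power2_eq_square)
  qed
  finally show "second > 1" using N_pos by simp
qed

text \<open>Multiplication by \<open>q\<close> sends \<open>N\<close> to \<open>q * N\<close> and
  \<open>q * N\<close> to \<open>n - N\<close>, so the residues alternate.\<close>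

lemma bnorm_second:
  "bnorm (int n) (int q ^ i * (int q * N)) = (if even i then int q * N else N)"
proof (induction i)
  case 0
  show ?case using N_pos q_ge_3 qN_less_half n_gt_1 by (auto intro!: bnorm_eqI)
next
  case (Suc i)
  have n0: "int n > 0" using n_gt_1 by simp
  have "bnorm (int n) (int q ^ Suc i * (int q * N)) = bnorm (int n) (int q * bnorm (int n) (int q ^ i * (int q * N)))"
    using bnorm_mult[OF n0] by (simp add: mult.assoc)
  also have "\<dots> = (if even (Suc i) then int q * N else N)"
  proof (cases "even i")
    case True
    have "int q * (int q * N) + N = int n" unfolding N_eq[symmetric] by (simp add: algebra_simps power2_eq_square)
    moreover have "N \<le> int q * N" using N_pos q_ge_3 by simp
    then have "2 * N \<le> int n" using qN_less_half by linarith
    ultimately have "bnorm (int n) (int q * (int q * N)) = N"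
      using N_pos n0 by (intro bnorm_eqI) auto
    then show ?thesis using Suc True by simp
  next
    case False
    have "bnorm (int n) (int q * N) = int q * N"
      using N_pos q_ge_3 qN_less_half n_gt_1 by (auto intro!: bnorm_eqI)
    then show ?thesis using Suc False by simp
  qed
  finally show ?case .
qed

lemma second_MinRep: "second \<in> MinRep q n"
proof -
  have "int (h - second) = int q * N" using second_eq by simp
  moreover have "N \<le> int q * N" using N_pos q_ge_3 by simp
  ultimately show ?thesis unfolding MinRep_iff_bnorm using second_eq(2) bnorm_second by auto
qed

text \<open>\<open>q ^ 2\<close> negates \<open>q * N\<close> modulo \<open>n\<close>, which gives
  period 4: an odd number of steps changes the residue, and two steps change the sign.\<close>

lemma card_cyc_coset_second: "card (cyc_coset q n second) = 4"
proof (rule card_cyc_coset)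
  have e: "int (h - second) = int q * N" "second \<le> h" using second_eq by auto
  have "int q ^ 4 * (int q * N) - int q * N = int n * (int q * ((int q)\<^sup>2 - 1))"
    unfolding N_eq[symmetric] by (simp add: algebra_simps eval_nat_numeral)
  then show "[second * q ^ 4 = second] (mod n)" using cong_orbit_iff[OF e(2)] e(1) by simp
  fix i :: nat assume i: "0 < i" "i < 4"
  show "\<not> [second * q ^ i = second] (mod n)"
  proof
    assume "[second * q ^ i = second] (mod n)"
    then have d: "int n dvd int q ^ i * (int q * N) - int q * N"
      using cong_orbit_iff[OF e(2)] unfolding e(1) by simp
    then have "bnorm (int n) (int q ^ i * (int q * N)) = int q * N"
      using N_pos qN_less_half n_gt_1 by (intro bnorm_eqI) auto
    then have "even i" using bnorm_second[of i] N_pos q_ge_3 by (auto split: if_splits)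
    then have i2: "i = 2" using i by presburger
    have "int q ^ 2 * (int q * N) - int q * N = int n * int q - 2 * (int q * N)"
      unfolding N_eq[symmetric] by (simp add: algebra_simps eval_nat_numeral)
    then have "int n dvd 2 * (int q * N)" using d i2 by (metis dvd_diff_right_iff dvd_triv_left)
    moreover have "2 * (int q * N) > 0" using N_pos q_ge_3 by simp
    ultimately have "int n \<le> 2 * (int q * N)" by (intro zdvd_imp_le)
    then show False using qN_less_half by simp
  qed
qed auto

text \<open>By \<open>leader_dichotomy\<close> and \<open>bound_gt\<close> every leader other than
  \<open>h\<close> is at distance at least \<open>q * N\<close> from \<open>h\<close>, and
  \<open>second\<close> attains this distance.\<close>

lemma leaders:
  defines "d \<equiv> delta_leader q n"
  shows "d 1 = h" "d 2 = second" "d 3 \<in> MinRep q n" "d 4 < d 3" "d 3 < d 2"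
    and "\<And>a. a \<in> MinRep q n \<Longrightarrow> a \<in> {d 1, d 2, d 3} \<or> a \<le> d 4"
proof -
  have "{0, 1, second, h} \<subseteq> MinRep q n"
    using zero_MinRep one_MinRep second_MinRep h_MinRep by simp
  moreover have "card {0, 1, second, h} = 4" using second_eq by auto
  ultimately have "card (MinRep q n) \<ge> 4" using card_mono[OF finite_MinRep] by metis
  note top = top_four_rev_sorted_list[OF finite_MinRep this, folded delta_leader_def, folded d_def]
  show d1: "d 1 = h"
    using top(1,4-8) top(8)[OF h_MinRep] MinRep_iff_bnorm[of "d 1"] by force
  have "d 2 \<le> second"
  proof -
    have "int h - int (d 2) \<ge> int q * N"
      using leader_dichotomy[OF top(2)] bound_gt[of "int h - int (d 2)"] top(7) d1 by force
    then show ?thesis using second_eq by linarith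
  qed
  then show "d 2 = second" using top(4-8) top(8)[OF second_MinRep] second_eq(2) d1 by force
  show "d 3 \<in> MinRep q n" "d 4 < d 3" "d 3 < d 2" by (fact top)+
  show "\<And>a. a \<in> MinRep q n \<Longrightarrow> a \<in> {d 1, d 2, d 3} \<or> a \<le> d 4" by (fact top(8))
qed

end

text \<open>Modulo \<open>q ^ 2 + 1\<close> the square of \<open>q\<close> is \<open>-1\<close>, and
  \<open>4 * k + 2\<close> is twice an odd number. This makes \<open>N\<close>, and later
  \<open>L\<close>, an integer.\<close>

lemma square_plus_one_dvd: "(q::int)\<^sup>2 + 1 dvd q ^ (4 * k + 2) + 1"
proof (induction k)
  case (Suc k)
  have "q ^ (4 * Suc k + 2) + 1 = q ^ 4 * (q ^ (4 * k + 2) + 1) - (q\<^sup>2 + 1) * (q\<^sup>2 - 1)"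
    by (simp add: algebra_simps eval_nat_numeral)
  then show ?case using Suc by simp
qed (simp add: power2_eq_square)

section \<open>The coset of the third largest leader\<close>

context bch_length
begin

lemma card_cyc_coset_third: "card (cyc_coset q n (delta_leader q n 3)) = 2 * m"
proof (rule card_cyc_coset_bnorm)
  let ?d = "delta_leader q n"
  show pos: "0 < ?d 3" "?d 3 < h" using leaders second_eq(2) by auto
  define e where "e = int (h - ?d 3)"
  have e: "0 < e" "2 * e < int n" "e = int h - int (?d 3)" using pos n_eq_2h by (auto simp: e_def)
  have le: "bnorm (int n) (int q ^ i * e) \<le> e" for i
    using leaders(3) unfolding MinRep_iff_bnorm e_def by blast
  fix i assume i: "0 < i" "i < m"
  show "bnorm (int n) (int q ^ i * e) < e"
  proof (cases t)
    case 0
    then have i: "i = 1" and m: "m = 2" using i m_eq by auto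
    \<comment> \<open>For \<open>m = 2\<close> only this index is left. A return to \<open>e\<close>
      with either sign gives, after multiplication by the conjugate factor,
      \<open>n dvd (q ^ 2 - 1) * e\<close>, and the right side is \<open>-2 * e\<close> modulo
      \<open>n\<close>.\<close>
    have "bnorm (int n) (int q * e) \<noteq> e"
    proof
      assume "bnorm (int n) (int q * e) = e"
      then have "int n dvd int q * e - e \<or> int n dvd int q * e + e"
        using bnorm_cases[of "int n" "int q * e"] by simp
      then have "int n dvd (int q * e - e) * (int q + 1) \<or> int n dvd (int q * e + e) * (int q - 1)"
        using dvd_mult2 by blast
      moreover have "(int q * e - e) * (int q + 1) = int n * e - 2 * e"
        "(int q * e + e) * (int q - 1) = int n * e - 2 * e"
        unfolding n_eq m by (simp_all add: algebra_simps power2_eq_square)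
      ultimately have "int n dvd 2 * e" by (metis dvd_diff_right_iff dvd_triv_left)
      then have "int n \<le> 2 * e" using e by (intro zdvd_imp_le) auto
      then show False using e by simp
    qed
    then show ?thesis using le[of 1] unfolding i by simp
  next
    case (Suc s)
    define Z where "Z = int q ^ (4 * s)"
    have nZ: "int n = int q ^ 6 * Z + 1"
      unfolding n_eq m_eq Suc Z_def by (simp add: algebra_simps eval_nat_numeral power_add)
    obtain L where "int q ^ (4 * s + 2) + 1 = ((int q)\<^sup>2 + 1) * L"
      using square_plus_one_dvd[of "int q" s] by blast
    then have L: "((int q)\<^sup>2 + 1) * L = (int q)\<^sup>2 * Z + 1"
      unfolding Z_def by (simp add: power_add mult.commute power2_eq_square)
    define E where "E = int q * N + (int q - 1)\<^sup>2 * L"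
    note orb = third_orbit[OF _ Z_def nZ N_eq L E_def]
    have q3: "3 \<le> int q" using q_ge_3 by simp
    have E: "int q * N < E" "2 * E < int n" using orb(2,3)[OF q3] by auto
    have E0: "E > 0" using E(1) qN_pos by linarith
    have strict: "bnorm (int n) (int q ^ i * E) < E" if "0 < i" "i < m" for i
      using orb(4)[OF q3, of i] that m_eq Suc by simp
    \<comment> \<open>The candidate for the third leader. Being a leader below
      \<open>second\<close>, it yields \<open>e \<le> E\<close>; the dichotomy yields the
      converse.\<close>
    define w where "w = h - nat E"
    have w: "w \<le> h" "int (h - w) = E" using E E0 n_eq_2h by (auto simp: w_def)
    have "w \<in> MinRep q n"
      unfolding MinRep_iff_bnorm w(2)
    proof (intro conjI allI)
      fix j
      have "bnorm (int n) (int q ^ j * E) = bnorm (int n) (int q ^ (j mod m) * E)"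
        using bnorm_period[of "j mod m" "j div m" E] by simp
      moreover have "bnorm (int n) (int q ^ (j mod m) * E) \<le> E"
      proof (cases "j mod m = 0")
        case True
        then show ?thesis using bnorm_eqI[of "int n" E E] E E0 by simp
      next
        case False
        then show ?thesis using strict[of "j mod m"] m_pos by (simp add: less_imp_le)
      qed
      ultimately show "bnorm (int n) (int q ^ j * E) \<le> E" by simp
    qed (fact w)
    moreover have "w < second" using w E second_eq by linarith
    ultimately have "w \<le> ?d 3"
      using leaders(1,2,4,6) second_eq(2) by force
    then have "e \<le> E" using w e by linarith
    moreover have "E \<le> e"
    proof -
      let ?K = "int q ^ 4 * ((int q)\<^sup>2 + 1)"
      have "e \<noteq> int q * N" using leaders(2,5) second_eq(1) e by simp
      then have "int n * (int q ^ 5 + (int q - 1)\<^sup>2) \<le> e * ?K"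
        using leader_dichotomy[OF leaders(3)] pos e by simp
      then have "E * ?K \<le> e * ?K + (int q - 1)\<^sup>2 * (int q ^ 4 - 1)"
        unfolding orb(1)[OF q3] by simp
      \<comment> \<open>The defect of \<open>E\<close> is smaller than \<open>?K\<close>, so no
        smaller integer satisfies the bound.\<close>
      also have "(int q - 1)\<^sup>2 * (int q ^ 4 - 1) < ?K"
      proof -
        have "(int q - 1)\<^sup>2 \<le> (int q)\<^sup>2" using q3 by (intro power_mono) auto
        moreover have "0 \<le> int q ^ 4 - 1" using q3 by simp
        ultimately have "(int q - 1)\<^sup>2 * (int q ^ 4 - 1) \<le> (int q)\<^sup>2 * (int q ^ 4 - 1)"
          by (rule mult_right_mono)
        also have "\<dots> < ?K" using q3 by (simp add: algebra_simps add_pos_pos)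
        finally show ?thesis .
      qed
      finally have "E * ?K < (e + 1) * ?K" by (simp add: algebra_simps)
      then have "E < e + 1" by (rule mult_right_less_imp_less) simp
      then show ?thesis by simp
    qed
    ultimately have "e = E" by simp
    then show ?thesis using strict i by simp
  qed
qed

end

section \<open>Cyclic codes\<close>

lemma coeff_word_poly: "poly.coeff (word_poly n c) i = (if i < n then c i else 0)"
  unfolding word_poly_def by (simp add: coeff_sum if_distrib cong: if_cong)

lemma poly_word_poly: "poly (word_poly n c) x = (\<Sum>i<n. c i * x ^ i)"
  unfolding word_poly_def by (simp add: poly_sum poly_monom)

lemma coeff_word_poly_word: "c \<in> words F n \<Longrightarrow> poly.coeff (word_poly n c) = c"
  unfolding words_def by (auto simp: coeff_word_poly)

lemma degree_word_poly: "n > 0 \<Longrightarrow> degree (word_poly n c) < n"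
  by (rule degree_lessI) (auto simp: coeff_word_poly)

lemma monic_dvd_monic_eq:
  fixes p g :: "'a::field poly"
  assumes "g dvd p" "lead_coeff g = 1" "lead_coeff p = 1" "degree p \<le> degree g"
  shows "p = g"
proof -
  obtain c where c: "p = g * c" using assms(1) by blast
  have "lead_coeff c = 1" using assms(2,3) unfolding c lead_coeff_mult by simp
  moreover from this have "degree c = 0" using assms(2,4) unfolding c
    by (subst (asm) degree_mult_eq) auto
  ultimately have "c = 1" by (metis degree_0_id lead_coeff_pCons(1) degree_eq_zeroE one_pCons)
  then show ?thesis using c by simp
qed

text \<open>What the coding theory takes from the finite field: additivity of \<open>x ^ q\<close>
  and a primitive \<open>n\<close>-th root of unity \<open>\<beta>\<close>.\<close>

locale cyclic_frobenius = coprime_length q n for q n +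
  fixes \<beta> :: "'b::field_gcd"
  assumes frobenius_add: "\<And>x y :: 'b. (x + y) ^ q = x ^ q + y ^ q"
    and q_pos: "q > 0"
    and power_eq_iff: "\<And>i j. \<beta> ^ i = \<beta> ^ j \<longleftrightarrow> [i = j] (mod n)"
begin

abbreviation F :: "'b set" where "F \<equiv> subfield_q q"

lemma beta_nonzero: "\<beta> \<noteq> 0"
  using power_eq_iff[of 0 n] power_eq_iff[of 0 1] n_gt_1 by (auto simp: cong_def power_0_left)

lemma power_mod: "\<beta> ^ (i mod n) = \<beta> ^ i"
  unfolding power_eq_iff by simp

lemma inj_power: "inj_on (\<lambda>i. \<beta> ^ i) {..<n}"
  by (rule inj_onI) (simp add: power_eq_iff cong_def)

lemma frobenius_minus: "(- x :: 'b) ^ q = - (x ^ q)"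
  using frobenius_add[of x "- x"] q_pos by (simp add: eq_neg_iff_add_eq_0 add.commute zero_power)

lemma frobenius_sum: "(\<Sum>i\<in>A. f i :: 'b) ^ q = (\<Sum>i\<in>A. f i ^ q)"
  using q_pos by (induction A rule: infinite_finite_induct) (auto simp: frobenius_add)

lemma F_0: "0 \<in> F"
  unfolding subfield_q_def using q_pos by simp

text \<open>Polynomials over \<open>F\<close> are the fixed points of this map, which turns
  membership of the coefficients in \<open>F\<close> into an equation.\<close>

definition frob :: "'b poly \<Rightarrow> 'b poly" where
  "frob p = map_poly (\<lambda>x. x ^ q) p"

lemma coeff_frob: "poly.coeff (frob p) i = poly.coeff p i ^ q"
  unfolding frob_def using q_pos by (simp add: coeff_map_poly)

lemma poly_over_iff: "poly_over F p \<longleftrightarrow> frob p = p"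
  unfolding poly_over_def subfield_q_def by (auto simp: poly_eq_iff coeff_frob)

lemma frob_mult: "frob (p * r) = frob p * frob r"
  by (rule poly_eqI) (simp add: coeff_frob coeff_mult frobenius_sum power_mult_distrib)

lemma frob_1: "frob 1 = 1"
  by (rule poly_eqI) (use q_pos in \<open>simp add: coeff_frob\<close>)

lemma frob_prod: "frob (\<Prod>i\<in>A. f i) = (\<Prod>i\<in>A. frob (f i))"
  by (induction A rule: infinite_finite_induct) (auto simp: frob_mult frob_1)

lemma frob_linear: "frob [:- a, 1:] = [:- (a ^ q), 1:]"
  by (rule poly_eqI) (use q_pos in \<open>auto simp: coeff_frob coeff_pCons frobenius_minus split: nat.split\<close>)

lemma poly_frob: "poly (frob p) (x ^ q) = poly p x ^ q"
proof -
  have "degree (frob p) = degree p"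
    unfolding frob_def using q_pos by (cases "p = 0") (auto intro: map_poly_degree_eq)
  then have "poly (frob p) (x ^ q) = (\<Sum>i\<le>degree p. poly.coeff p i ^ q * (x ^ q) ^ i)"
    unfolding poly_altdef by (simp add: coeff_frob)
  also have "\<dots> = (\<Sum>i\<le>degree p. poly.coeff p i * x ^ i) ^ q"
    by (simp add: frobenius_sum power_mult_distrib power_commutes flip: power_mult) (simp add: mult.commute)
  finally show ?thesis unfolding poly_altdef .
qed

lemma poly_over_root_power:
  assumes "poly_over F p" "poly p x = 0"
  shows "poly p (x ^ (q ^ k)) = 0"
proof (induction k)
  case (Suc k)
  then show ?case
    using poly_frob[of p "x ^ (q ^ k)"] assms(1) q_pos
    by (simp add: poly_over_iff power_mult mult.commute flip: power_mult)
qed (use assms in simp)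

section \<open>Polynomials with prescribed powers of \<open>\<beta>\<close> as roots\<close>

definition root_poly :: "nat set \<Rightarrow> 'b poly" where
  "root_poly T = (\<Prod>j\<in>T. [:- (\<beta> ^ j), 1:])"

lemma lead_coeff_root_poly: "lead_coeff (root_poly T) = 1"
  unfolding root_poly_def by (simp add: lead_coeff_prod)

lemma root_poly_nonzero: "root_poly T \<noteq> 0"
  using lead_coeff_root_poly[of T] by auto

lemma degree_root_poly: "degree (root_poly T) = card T"
  unfolding root_poly_def by (subst degree_prod_eq_sum_degree) auto

lemma root_poly_dvd_iff:
  assumes "T \<subseteq> {..<n}"
  shows "root_poly T dvd p \<longleftrightarrow> (\<forall>j\<in>T. poly p (\<beta> ^ j) = 0)"
proof
  assume "root_poly T dvd p"
  moreover have "[:- (\<beta> ^ j), 1:] dvd root_poly T" if "j \<in> T" for j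
    unfolding root_poly_def using that finite_subset[OF assms] by (intro dvd_prodI) auto
  ultimately show "\<forall>j\<in>T. poly p (\<beta> ^ j) = 0" unfolding poly_eq_0_iff_dvd using dvd_trans by blast
next
  have "finite T" using assms finite_subset by blast
  then show "\<forall>j\<in>T. poly p (\<beta> ^ j) = 0 \<Longrightarrow> root_poly T dvd p" using assms
  proof (induction T)
    case (insert j T)
    then obtain c where c: "p = root_poly T * c" by auto
    have "poly (root_poly T) (\<beta> ^ j) \<noteq> 0"
      unfolding root_poly_def poly_prod using insert(1,2,5) inj_power
      by (auto simp: prod_zero_iff inj_on_def)
    then have "poly c (\<beta> ^ j) = 0" using insert.prems(1) c by auto
    then have "[:- (\<beta> ^ j), 1:] dvd c" by (simp add: poly_eq_0_iff_dvd)
    then have "[:- (\<beta> ^ j), 1:] * root_poly T dvd p" unfolding c mult.commute[of _ c] by (rule mult_dvd_mono) simp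
    moreover have "root_poly (insert j T) = [:- (\<beta> ^ j), 1:] * root_poly T"
      unfolding root_poly_def by (rule prod.insert[OF insert(1,2)])
    ultimately show ?case by simp
  qed (simp add: root_poly_def)
qed

text \<open>Characterizes the unions of cyclotomic cosets by one-step closure.\<close>

definition q_closed :: "nat set \<Rightarrow> bool" where
  "q_closed T \<longleftrightarrow> T \<subseteq> {..<n} \<and> (\<forall>j\<in>T. j * q mod n \<in> T)"

lemma q_closed_cyc_coset: "q_closed (cyc_coset q n s)"
  unfolding q_closed_def using cyc_coset_less cyc_coset_step[where i = 1] by auto

lemma q_closed_UN: "(\<And>i. i \<in> A \<Longrightarrow> q_closed (B i)) \<Longrightarrow> q_closed (\<Union>i\<in>A. B i)"
  unfolding q_closed_def by fast

text \<open>Multiplication by \<open>q\<close> permutes \<open>T\<close>, so Frobenius merely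
  permutes the linear factors.\<close>

lemma poly_over_root_poly:
  assumes "q_closed T" shows "poly_over F (root_poly T)"
proof -
  have T: "T \<subseteq> {..<n}" "finite T" using assms finite_subset unfolding q_closed_def by blast+
  have inj: "inj_on (\<lambda>j. j * q mod n) T"
  proof (rule inj_onI)
    fix i j assume ij: "i \<in> T" "j \<in> T" "i * q mod n = j * q mod n"
    then have "[i = j] (mod n)"
      using coprime_n_q by (simp add: cong_def[symmetric] cong_mult_rcancel_nat coprime_commute)
    moreover have "i < n" "j < n" using ij T by auto
    ultimately show "i = j" by (simp add: cong_def)
  qed
  have "(\<lambda>j. j * q mod n) ` T \<subseteq> T" using assms unfolding q_closed_def by blast
  then have im: "(\<lambda>j. j * q mod n) ` T = T" using inj T(2) endo_inj_surj by blast
  have "frob (root_poly T) = (\<Prod>j\<in>T. [:- (\<beta> ^ (j * q mod n)), 1:])"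
    unfolding root_poly_def frob_prod frob_linear by (simp add: power_mod power_mult)
  also have "\<dots> = (\<Prod>j\<in>(\<lambda>j. j * q mod n) ` T. [:- (\<beta> ^ j), 1:])"
    by (simp add: prod.reindex[OF inj])
  finally show ?thesis unfolding im poly_over_iff root_poly_def .
qed

lemma root_poly_coset_dvd:
  assumes "poly_over F p" "poly p (\<beta> ^ i) = 0"
  shows "root_poly (cyc_coset q n i) dvd p"
proof (subst root_poly_dvd_iff)
  show "cyc_coset q n i \<subseteq> {..<n}" using cyc_coset_less by auto
  show "\<forall>j\<in>cyc_coset q n i. poly p (\<beta> ^ j) = 0"
    unfolding cyc_coset_eq using poly_over_root_power[OF assms] by (auto simp: power_mod power_mult)
qed

lemma poly_root_poly_coset: "poly (root_poly (cyc_coset q n i)) (\<beta> ^ i) = 0"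
proof -
  have "i mod n \<in> cyc_coset q n i" unfolding cyc_coset_eq by (rule range_eqI[of _ _ 0]) simp
  moreover have "cyc_coset q n i \<subseteq> {..<n}" using cyc_coset_less by auto
  ultimately have "poly (root_poly (cyc_coset q n i)) (\<beta> ^ (i mod n)) = 0"
    using root_poly_dvd_iff dvd_refl by blast
  then show ?thesis by (simp add: power_mod)
qed

text \<open>A polynomial over \<open>F\<close> that vanishes at \<open>\<beta> ^ i\<close> vanishes
  on the whole coset, so the monic product divides it. This settles both minimality and the
  uniqueness that \<open>THE\<close> requires.\<close>

lemma minpoly_eq: "minpoly F (\<beta> ^ i) = root_poly (cyc_coset q n i)"
  unfolding minpoly_def
proof (rule the_equality, safe)
  let ?r = "root_poly (cyc_coset q n i)"
  show "lead_coeff ?r = 1" by (rule lead_coeff_root_poly)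
  show over: "poly_over F ?r" by (rule poly_over_root_poly[OF q_closed_cyc_coset])
  show root: "poly ?r (\<beta> ^ i) = 0" by (rule poly_root_poly_coset)
  show "degree ?r \<le> degree p" if "p \<noteq> 0" "poly_over F p" "poly p (\<beta> ^ i) = 0" for p
    using root_poly_coset_dvd[OF that(2,3)] that(1) by (rule dvd_imp_degree_le)
  fix p assume p: "lead_coeff p = 1" "poly_over F p" "poly p (\<beta> ^ i) = 0"
    and min: "\<forall>p'. p' \<noteq> 0 \<and> poly_over F p' \<and> poly p' (\<beta> ^ i) = 0 \<longrightarrow> degree p \<le> degree p'"
  show "p = ?r"
    using root_poly_coset_dvd[OF p(2,3)] lead_coeff_root_poly p(1)
      min[rule_format, of ?r] root_poly_nonzero over root
    by (intro monic_dvd_monic_eq) auto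
qed

lemma q_closed_zeros: "q_closed (zeros b e)"
  unfolding zeros_def by (rule q_closed_UN) (rule q_closed_cyc_coset)

text \<open>The minimal polynomials are products of distinct linear factors, so the least common
  multiple corresponds to the union of the exponent sets. Being monic, the product is
  normalized.\<close>

lemma gen_poly_eq: "gen_poly F \<beta> \<delta> b = root_poly (zeros b (b + \<delta> - 2))"
  unfolding gen_poly_def
proof (rule Lcm_eqI)
  let ?T = "zeros b (b + \<delta> - 2)"
  have T: "?T \<subseteq> {..<n}" using q_closed_zeros unfolding q_closed_def by blast
  have C: "cyc_coset q n i \<subseteq> {..<n}" for i using q_closed_cyc_coset unfolding q_closed_def by blast
  show "normalize (root_poly ?T) = root_poly ?T"
    by (rule poly_eqI) (simp add: lead_coeff_root_poly)
  show "p dvd root_poly ?T" if p: "p \<in> (\<lambda>i. minpoly F (\<beta> ^ i)) ` {b..b + \<delta> - 2}" for p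
  proof -
    obtain i where i: "i \<in> {b..b + \<delta> - 2}" "p = root_poly (cyc_coset q n i)"
      using p unfolding minpoly_eq by blast
    have "cyc_coset q n i \<subseteq> ?T" unfolding zeros_def using i by blast
    moreover have "\<forall>j\<in>?T. poly (root_poly ?T) (\<beta> ^ j) = 0" 
      by (rule root_poly_dvd_iff[OF T, THEN iffD1, OF dvd_refl])
    ultimately show ?thesis unfolding i root_poly_dvd_iff[OF C] by blast
  qed
  show "root_poly ?T dvd p" if p: "\<And>g. g \<in> (\<lambda>i. minpoly F (\<beta> ^ i)) ` {b..b + \<delta> - 2} \<Longrightarrow> g dvd p" for p
  proof -
    have "root_poly (cyc_coset q n i) dvd p" if "i \<in> {b..b + \<delta> - 2}" for i
      using p[OF imageI[OF that]] unfolding minpoly_eq .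
    then show ?thesis unfolding root_poly_dvd_iff[OF T] root_poly_dvd_iff[OF C]
      unfolding zeros_def by blast
  qed
qed

lemma cyclic_code_iff:
  assumes "q_closed T"
  shows "c \<in> cyclic_code F n (root_poly T) \<longleftrightarrow>
    c \<in> words F n \<and> (\<forall>j\<in>T. poly (word_poly n c) (\<beta> ^ j) = 0)"
proof -
  have T: "T \<subseteq> {..<n}" using assms unfolding q_closed_def by blast
  \<comment> \<open>Frobenius fixes both the word polynomial and \<open>root_poly T\<close>, so
    cancelling the latter leaves \<open>frob r = r\<close>.\<close>
  have "poly_over F r" if "c \<in> words F n" "word_poly n c = root_poly T * r" for r
  proof -
    have "poly_over F (word_poly n c)" unfolding poly_over_def coeff_word_poly_word[OF that(1)]
      using that(1) unfolding words_def by blast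
    then have "root_poly T * frob r = root_poly T * r"
      using that(2) poly_over_root_poly[OF assms] unfolding poly_over_iff by (metis frob_mult)
    then show ?thesis unfolding poly_over_iff using root_poly_nonzero by simp
  qed
  then show ?thesis
    unfolding cyclic_code_def root_poly_dvd_iff[OF T, symmetric] by (auto simp: dvd_def)
qed

lemma word_eq_0:
  assumes "c \<in> words F n" "\<And>j. j < n \<Longrightarrow> poly (word_poly n c) (\<beta> ^ j) = 0"
  shows "c = (\<lambda>_. 0)"
proof -
  have "word_poly n c = 0"
  proof (rule poly_eqI_degree)
    show "card ((\<lambda>i. \<beta> ^ i) ` {..<n}) > degree (word_poly n c)"
      using degree_word_poly[of n c] n_gt_1 by (simp add: card_image[OF inj_power])
    then show "card ((\<lambda>i. \<beta> ^ i) ` {..<n}) > degree (0 :: 'b poly)" by simp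
  qed (use assms in auto)
  then show ?thesis using coeff_word_poly_word[OF assms(1)] by auto
qed

section \<open>Cyclic shifts and the LCD property\<close>

lemma sum_shift: "(\<Sum>i<n. f ((i + k) mod n)) = (\<Sum>i<n. f i)" for f :: "nat \<Rightarrow> 'b"
proof -
  have inj: "inj_on (\<lambda>i. (i + k) mod n) {..<n}"
  proof (rule inj_onI)
    fix i j assume ij: "i \<in> {..<n}" "j \<in> {..<n}" "(i + k) mod n = (j + k) mod n"
    then have "[i = j] (mod n)" by (simp add: cong_def[symmetric] cong_add_rcancel_nat)
    then show "i = j" using ij by (simp add: cong_def)
  qed
  have "(\<lambda>i. (i + k) mod n) ` {..<n} \<subseteq> {..<n}" using n_gt_1 by auto
  then have "(\<lambda>i. (i + k) mod n) ` {..<n} = {..<n}" using inj endo_inj_surj by blast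
  then show ?thesis using sum.reindex[OF inj, of f] by simp
qed

definition shift :: "nat \<Rightarrow> (nat \<Rightarrow> 'b) \<Rightarrow> nat \<Rightarrow> 'b" where
  "shift k c = (\<lambda>i. if i < n then c ((i + k) mod n) else 0)"

lemma poly_shift:
  "(\<beta> ^ j) ^ k * poly (word_poly n (shift k c)) (\<beta> ^ j) = poly (word_poly n c) (\<beta> ^ j)"
proof -
  have "(\<beta> ^ j) ^ k * poly (word_poly n (shift k c)) (\<beta> ^ j)
      = (\<Sum>i<n. c ((i + k) mod n) * (\<beta> ^ j) ^ ((i + k) mod n))"
    unfolding poly_word_poly sum_distrib_left
  proof (rule sum.cong)
    fix i assume i: "i \<in> {..<n}"
    have "(\<beta> ^ j) ^ ((i + k) mod n) = (\<beta> ^ j) ^ (i + k)"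
      unfolding power_mult[symmetric] power_eq_iff by (metis cong_def mod_mult_right_eq)
    then show "(\<beta> ^ j) ^ k * (shift k c i * (\<beta> ^ j) ^ i) = c ((i + k) mod n) * (\<beta> ^ j) ^ ((i + k) mod n)"
      using i by (simp add: shift_def power_add mult_ac)
  qed simp
  also have "\<dots> = poly (word_poly n c) (\<beta> ^ j)"
    unfolding poly_word_poly by (rule sum_shift[of "\<lambda>l. c l * (\<beta> ^ j) ^ l"])
  finally show ?thesis .
qed

lemma shift_in_code:
  assumes "q_closed T" "c \<in> cyclic_code F n (root_poly T)"
  shows "shift k c \<in> cyclic_code F n (root_poly T)"
proof -
  have "shift k c \<in> words F n"
    using assms(2) F_0 unfolding cyclic_code_iff[OF assms(1)] words_def shift_def by auto
  moreover have "poly (word_poly n (shift k c)) (\<beta> ^ j) = 0" if "j \<in> T" for j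
    using poly_shift[of j k c] that assms(2) beta_nonzero unfolding cyclic_code_iff[OF assms(1)] by auto
  ultimately show ?thesis unfolding cyclic_code_iff[OF assms(1)] by blast
qed

text \<open>The discrete Fourier transform of the cyclic autocorrelation of \<open>x\<close>. The
  exponent \<open>n - j\<close> stands for \<open>- j\<close>.\<close>

lemma poly_inverse_product:
  assumes "j < n"
  shows "poly (word_poly n x) (\<beta> ^ j) * poly (word_poly n x) (\<beta> ^ (n - j))
    = (\<Sum>k<n. (\<beta> ^ j) ^ k * dot n x (shift k x))"
proof -
  have inv: "\<beta> ^ j * \<beta> ^ (n - j) = 1"
    using power_eq_iff[of n 0] assms by (simp add: cong_def flip: power_add)
  \<comment> \<open>For each index \<open>i\<close> of the second factor the sum of the first one is
    rotated to start at \<open>i\<close>, so that the inner index becomes the shift.\<close>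
  have "poly (word_poly n x) (\<beta> ^ j) = (\<Sum>k<n. x ((k + i) mod n) * (\<beta> ^ j) ^ ((k + i) mod n))" for i
    unfolding poly_word_poly by (rule sum_shift[of "\<lambda>l. x l * (\<beta> ^ j) ^ l", symmetric])
  then have "poly (word_poly n x) (\<beta> ^ j) * poly (word_poly n x) (\<beta> ^ (n - j))
    = (\<Sum>i<n. (\<Sum>k<n. x ((k + i) mod n) * (\<beta> ^ j) ^ ((k + i) mod n)) * (x i * (\<beta> ^ (n - j)) ^ i))"
    unfolding poly_word_poly[of n x "\<beta> ^ (n - j)"] sum_distrib_left by (intro sum.cong) auto
  also have "\<dots> = (\<Sum>i<n. \<Sum>k<n. (\<beta> ^ j) ^ k * (x i * shift k x i))"
    unfolding sum_distrib_right
  proof (intro sum.cong)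
    fix i k assume ik: "i \<in> {..<n}" "k \<in> {..<n}"
    have "(\<beta> ^ j) ^ ((k + i) mod n) = (\<beta> ^ j) ^ (k + i)"
      unfolding power_mult[symmetric] power_eq_iff by (metis cong_def mod_mult_right_eq)
    moreover have "(\<beta> ^ j) ^ i * (\<beta> ^ (n - j)) ^ i = 1"
      using inv by (simp flip: power_mult_distrib)
    ultimately show "x ((k + i) mod n) * (\<beta> ^ j) ^ ((k + i) mod n) * (x i * (\<beta> ^ (n - j)) ^ i)
      = (\<beta> ^ j) ^ k * (x i * shift k x i)"
      using ik by (simp add: shift_def power_add add.commute[of k i] mult_ac)
  qed auto
  also have "\<dots> = (\<Sum>k<n. (\<beta> ^ j) ^ k * dot n x (shift k x))"
    unfolding dot_def sum_distrib_left by (rule sum.swap)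
  finally show ?thesis .
qed

text \<open>As \<open>q ^ M\<close> is \<open>-1\<close> modulo \<open>n\<close>, the inverse of
  \<open>\<beta> ^ j\<close> is one of its Frobenius conjugates.\<close>

lemma poly_neg_root:
  assumes "n dvd q ^ M + 1" "c \<in> words F n" "j \<le> n" "poly (word_poly n c) (\<beta> ^ j) = 0"
  shows "poly (word_poly n c) (\<beta> ^ (n - j)) = 0"
proof -
  have "poly_over F (word_poly n c)" unfolding poly_over_def coeff_word_poly_word[OF assms(2)]
    using assms(2) unfolding words_def by blast
  then have "poly (word_poly n c) ((\<beta> ^ j) ^ (q ^ M)) = 0" using poly_over_root_power assms(4) by blast
  moreover have "(\<beta> ^ j) ^ (q ^ M) = \<beta> ^ (n - j)"
  proof -
    have "n dvd j * q ^ M + j" using dvd_mult[OF assms(1), of j] by (simp add: algebra_simps)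
    then have "[j * q ^ M + j = (n - j) + j] (mod n)" using assms(3) by (simp add: cong_def)
    then have "[j * q ^ M = n - j] (mod n)" by (simp add: cong_add_rcancel_nat)
    then show ?thesis by (simp add: power_eq_iff flip: power_mult)
  qed
  ultimately show ?thesis by simp
qed

lemma LCD_root_poly:
  assumes "n dvd q ^ M + 1" "q_closed T"
  shows "is_LCD F n (cyclic_code F n (root_poly T))"
proof -
  let ?C = "cyclic_code F n (root_poly T)"
  have 0: "(\<lambda>_. 0) \<in> ?C"
    unfolding cyclic_code_iff[OF assms(2)] words_def using F_0 by (simp add: poly_word_poly)
  then have "(\<lambda>_. 0) \<in> dual_code F n ?C"
    unfolding dual_code_def cyclic_code_iff[OF assms(2)] by (simp add: dot_def)
  moreover have "x = (\<lambda>_. 0)" if x: "x \<in> ?C" "x \<in> dual_code F n ?C" for x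
  proof (rule word_eq_0)
    show w: "x \<in> words F n" using x unfolding dual_code_def by blast
    fix j assume j: "j < n"
    have "dot n x (shift k x) = 0" for k
      using x shift_in_code[OF assms(2) x(1)] unfolding dual_code_def by blast
    then have "poly (word_poly n x) (\<beta> ^ j) * poly (word_poly n x) (\<beta> ^ (n - j)) = 0"
      unfolding poly_inverse_product[OF j] by simp
    moreover have "poly (word_poly n x) (\<beta> ^ (n - (n - j))) = 0" if "poly (word_poly n x) (\<beta> ^ (n - j)) = 0"
      by (rule poly_neg_root[OF assms(1) w _ that]) simp
    ultimately show "poly (word_poly n x) (\<beta> ^ j) = 0" using j by auto
  qed
  ultimately show ?thesis unfolding is_LCD_def using 0 by blast
qed

text \<open>If there are at most \<open>D\<close> nonzero entries, the polynomial \<open>f\<close>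
  that vanishes at all support positions except \<open>s\<close> has degree below \<open>D\<close>.
  Weighting the consecutive zeros with the coefficients of \<open>f\<close> isolates the entry at
  \<open>s\<close>; this takes the place of a Vandermonde determinant.\<close>

lemma BCH_bound:
  assumes c: "c \<in> words F n" "c \<noteq> (\<lambda>_. 0)"
    and z: "\<And>i. i < D \<Longrightarrow> poly (word_poly n c) (\<beta> ^ (b + i)) = 0"
  shows "D < weight c"
proof (rule ccontr)
  assume a: "\<not> ?thesis"
  define S where "S = {i. c i \<noteq> 0}"
  have S: "S \<subseteq> {..<n}" using c(1) unfolding S_def words_def by (auto simp: not_less[symmetric])
  then have fin: "finite S" using finite_subset by blast
  obtain s where s: "s \<in> S" using c(2) unfolding S_def by auto
  define f where "f = root_poly (S - {s})"
  have "card (S - {s}) < D" using a s fin card_gt_0_iff[of S]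
    by (auto simp: weight_def S_def[symmetric])
  then have deg: "degree f < D" by (simp add: f_def degree_root_poly)
  have S': "S - {s} \<subseteq> {..<n}" using S by blast
  have f0: "poly f (\<beta> ^ i) = 0" if "i \<in> S - {s}" for i
    using root_poly_dvd_iff[OF S', THEN iffD1, OF dvd_refl] that unfolding f_def by blast
  have fs: "poly f (\<beta> ^ s) \<noteq> 0"
    unfolding f_def root_poly_def poly_prod using s S inj_power fin
    by (auto simp: prod_zero_iff inj_on_def)
  have "0 = (\<Sum>k\<le>degree f. poly.coeff f k * poly (word_poly n c) (\<beta> ^ (b + k)))"
    using z deg by simp
  also have "\<dots> = (\<Sum>k\<le>degree f. \<Sum>i<n. c i * (\<beta> ^ i) ^ b * (poly.coeff f k * (\<beta> ^ i) ^ k))"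
  proof -
    have "(\<beta> ^ (b + k)) ^ i = (\<beta> ^ i) ^ b * (\<beta> ^ i) ^ k" for i k
      by (simp add: algebra_simps flip: power_mult power_add)
    then show ?thesis unfolding poly_word_poly sum_distrib_left by (simp add: mult_ac)
  qed
  also have "\<dots> = (\<Sum>i<n. c i * (\<beta> ^ i) ^ b * poly f (\<beta> ^ i))"
    unfolding poly_altdef sum_distrib_left by (rule sum.swap)
  also have "\<dots> = (\<Sum>i\<in>{s}. c i * (\<beta> ^ i) ^ b * poly f (\<beta> ^ i))"
  proof (rule sum.mono_neutral_right)
    show "\<forall>i\<in>{..<n} - {s}. c i * (\<beta> ^ i) ^ b * poly f (\<beta> ^ i) = 0"
      using f0 unfolding S_def by auto
  qed (use s S in auto)
  finally show False using fs s beta_nonzero unfolding S_def by simp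
qed

text \<open>The products of the generator with the monomials of degree below
  \<open>n - card T\<close> form a basis: a combination of them is the coefficient sequence of
  \<open>?g * h\<close>, where \<open>h\<close> collects the scalars.\<close>

lemma code_dim_root_poly:
  assumes "q_closed T"
  shows "code_dim F (cyclic_code F n (root_poly T)) (n - card T)"
proof -
  let ?g = "root_poly T"
  let ?C = "cyclic_code F n ?g"
  define k where "k = n - card T"
  define w where "w i = poly.coeff (?g * Polynomial.monom 1 i)" for i
  have T: "T \<subseteq> {..<n}" using assms unfolding q_closed_def by blast
  then have cT: "card T \<le> n" using card_mono[of "{..<n}" T] by simp
  have degw: "degree (?g * Polynomial.monom 1 i) = card T + i" for i
    by (subst degree_mult_eq) (auto simp: root_poly_nonzero degree_root_poly degree_monom_eq)
  have inj: "inj_on w {..<k}"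
  proof (rule inj_onI)
    fix i j assume "w i = w j"
    then have "?g * Polynomial.monom 1 i = ?g * Polynomial.monom 1 j" 
      unfolding w_def by (simp only: coeff_inject)
    then show "i = j" using degw[of i] degw[of j] by (metis add_left_cancel)
  qed
  have comb: "lin_comb (w ` {..<k}) f = poly.coeff (?g * (\<Sum>i<k. Polynomial.monom (f (w i)) i))" for f
  proof
    fix l
    have "lin_comb (w ` {..<k}) f l = (\<Sum>i<k. f (w i) * w i l)"
      unfolding lin_comb_def by (simp add: sum.reindex[OF inj])
    also have "\<dots> = (\<Sum>i<k. poly.coeff (?g * Polynomial.monom (f (w i)) i) l)"
    proof (rule sum.cong)
      fix i
      have "?g * Polynomial.monom (f (w i)) i = Polynomial.smult (f (w i)) (?g * Polynomial.monom 1 i)"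
        by (metis mult_smult_right smult_monom mult.right_neutral)
      then show "f (w i) * w i l = poly.coeff (?g * Polynomial.monom (f (w i)) i) l" by (simp add: w_def)
    qed simp
    finally show "lin_comb (w ` {..<k}) f l = poly.coeff (?g * (\<Sum>i<k. Polynomial.monom (f (w i)) i)) l"
      by (simp add: sum_distrib_left coeff_sum)
  qed
  have coefk: "poly.coeff (\<Sum>i<k. Polynomial.monom (a i) i) j = (if j < k then a j else 0)" for a :: "nat \<Rightarrow> 'b" and j
    by (simp add: coeff_sum if_distrib cong: if_cong)
  have span: "lin_comb (w ` {..<k}) f \<in> ?C" if "\<forall>v\<in>w ` {..<k}. f v \<in> F" for f
  proof -
    let ?h = "\<Sum>i<k. Polynomial.monom (f (w i)) i"
    have h: "poly_over F ?h" unfolding poly_over_def coefk using that F_0 by auto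
    have gh: "poly_over F (?g * ?h)"
      using poly_over_root_poly[OF assms] h unfolding poly_over_iff frob_mult by simp
    have "poly.coeff (?g * ?h) l = 0" if "l \<ge> n" for l
    proof (cases "?h = 0")
      case False
      have "degree ?h < k"
      proof (rule degree_lessI)
        show "?h \<noteq> 0 \<or> 0 < k" using False by blast
      qed (simp add: coefk)
      then have "degree (?g * ?h) < n"
        using False cT by (subst degree_mult_eq) (auto simp: root_poly_nonzero degree_root_poly k_def)
      then show ?thesis using that by (simp add: coeff_eq_0)
    qed simp
    then have "poly.coeff (?g * ?h) \<in> words F n" and "word_poly n (poly.coeff (?g * ?h)) = ?g * ?h"
      using gh unfolding words_def poly_over_def by (auto intro!: poly_eqI simp: coeff_word_poly not_less)
    then show ?thesis unfolding comb cyclic_code_def using h by blast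
  qed
  have "w i \<in> ?C" if "i < k" for i
  proof -
    have "lin_comb (w ` {..<k}) (\<lambda>v. if v = w i then 1 else 0) = w i"
      unfolding lin_comb_def using that by (auto simp: if_distrib[of "\<lambda>x. x * _"] cong: if_cong)
    moreover have "1 \<in> F" unfolding subfield_q_def by simp
    ultimately show ?thesis using span[of "\<lambda>v. if v = w i then 1 else 0"] F_0 by auto
  qed
  then have sub: "w ` {..<k} \<subseteq> ?C" by blast
  have indep: "F_indep F (w ` {..<k})"
    unfolding F_indep_def
  proof (intro allI impI ballI)
    fix f v assume f: "(\<forall>v\<in>w ` {..<k}. f v \<in> F) \<and> lin_comb (w ` {..<k}) f = (\<lambda>_. 0)"
      and "v \<in> w ` {..<k}"
    then obtain i where i: "i < k" "v = w i" by blast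
    have "?g * (\<Sum>i<k. Polynomial.monom (f (w i)) i) = 0"
      using f unfolding comb by (intro poly_eqI) (auto dest: fun_cong)
    then have "(\<Sum>i<k. Polynomial.monom (f (w i)) i) = 0" using root_poly_nonzero by simp
    then show "f v = 0" using coefk[of "\<lambda>i. f (w i)" i] i by simp
  qed
  have "c \<in> F_span F (w ` {..<k})" if c: "c \<in> ?C" for c
  proof -
    obtain r where r: "poly_over F r" "word_poly n c = ?g * r" "c \<in> words F n"
      using c unfolding cyclic_code_def by blast
    \<comment> \<open>Scalars are attached to basis vectors, so the exponent is recovered with the
      inverse of \<open>w\<close>.\<close>
    define f where "f v = poly.coeff r (inv_into {..<k} w v)" for v
    have fw: "f (w i) = poly.coeff r i" if "i < k" for i
      using inj that by (simp add: f_def)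
    have "r = (\<Sum>i<k. Polynomial.monom (f (w i)) i)"
    proof (rule poly_eqI)
      fix l
      have "poly.coeff r l = 0" if "l \<ge> k"
      proof (cases "r = 0")
        case False
        have "degree (?g * r) < n" using degree_word_poly[of n c] n_gt_1 r(2) by simp
        then have "card T + degree r < n"
          using False by (subst (asm) degree_mult_eq) (auto simp: root_poly_nonzero degree_root_poly)
        then show ?thesis using that by (intro coeff_eq_0) (simp add: k_def)
      qed simp
      then show "poly.coeff r l = poly.coeff (\<Sum>i<k. Polynomial.monom (f (w i)) i) l"
        unfolding coefk using fw by auto
    qed
    then have "lin_comb (w ` {..<k}) f = c"
      unfolding comb using r(2) coeff_word_poly_word[OF r(3)] by simp
    moreover have "\<forall>v\<in>w ` {..<k}. f v \<in> F" using r(1) unfolding f_def poly_over_def by blast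
    ultimately show ?thesis unfolding F_span_def by blast
  qed
  then have "F_span F (w ` {..<k}) = ?C" using span unfolding F_span_def by blast
  then show ?thesis
    unfolding code_dim_def k_def[symmetric] using sub indep card_image[OF inj]
    by (intro exI[of _ "w ` {..<k}"]) auto
qed

end

section \<open>Finite fields\<close>

text \<open>Multiplication by \<open>x\<close> permutes the nonzero elements; their product is
  compared before and after.\<close>

lemma power_card_minus_one:
  fixes x :: "'b::{finite,field}"
  assumes "x \<noteq> 0"
  shows "x ^ (card (UNIV :: 'b set) - 1) = 1"
proof -
  let ?U = "UNIV - {0 :: 'b}"
  have inj: "inj_on (\<lambda>y. x * y) ?U" using assms by (auto intro: inj_onI)
  moreover have "(\<lambda>y. x * y) ` ?U \<subseteq> ?U" using assms by auto
  ultimately have "(\<lambda>y. x * y) ` ?U = ?U" by (intro endo_inj_surj) auto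
  with inj have "(\<Prod>y\<in>?U. x * y) = \<Prod>?U" using prod.reindex[of "\<lambda>y. x * y" ?U id] by simp
  then have "x ^ card ?U * \<Prod>?U = \<Prod>?U" by (simp add: prod.distrib)
  moreover have "\<Prod>?U \<noteq> 0" by simp
  ultimately show ?thesis by simp
qed

lemma card_UNIV_minus_one_pos: "card (UNIV :: 'b::{finite,field} set) - 1 > 0"
proof -
  have "card {0, 1 :: 'b} \<le> card (UNIV :: 'b set)" by (rule card_mono) auto
  then show ?thesis by simp
qed

lemma primitive_elem_power_eq_1_iff:
  fixes \<alpha> :: "'b::{finite,field}"
  assumes "primitive_elem \<alpha>"
  shows "\<alpha> ^ k = 1 \<longleftrightarrow> card (UNIV :: 'b set) - 1 dvd k"
proof
  let ?Q = "card (UNIV :: 'b set) - 1"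
  have one: "\<alpha> ^ ?Q = 1" using assms by (intro power_card_minus_one) (simp add: primitive_elem_def)
  show "\<alpha> ^ k = 1" if "?Q dvd k" using that one by (auto simp: power_mult)
  assume "\<alpha> ^ k = 1"
  define r where "r = k mod ?Q"
  have "\<alpha> ^ (?Q * (k div ?Q) + r) = 1" using \<open>\<alpha> ^ k = 1\<close> by (simp add: r_def)
  then have r: "\<alpha> ^ r = 1" unfolding power_add power_mult one by simp
  have cardU: "card (UNIV - {0 :: 'b}) = ?Q" by (simp add: card_Diff_subset)
  \<comment> \<open>For positive \<open>r\<close> the powers with exponents below \<open>r\<close>
    would exhaust the nonzero elements, of which there are \<open>?Q > r\<close>.\<close>
  have "r = 0"
  proof (rule ccontr)
    assume "r \<noteq> 0"
    have "UNIV - {0} \<subseteq> (\<lambda>i. \<alpha> ^ i) ` {..<r}"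
    proof
      fix x :: 'b assume "x \<in> UNIV - {0}"
      then obtain l where l: "\<alpha> ^ l = x" using assms unfolding primitive_elem_def by auto
      have "\<alpha> ^ (r * (l div r) + l mod r) = \<alpha> ^ (l mod r)" unfolding power_add power_mult r by simp
      then have "x = \<alpha> ^ (l mod r)" using l by simp
      then show "x \<in> (\<lambda>i. \<alpha> ^ i) ` {..<r}" using \<open>r \<noteq> 0\<close> by simp
    qed
    then have "?Q \<le> card ((\<lambda>i. \<alpha> ^ i) ` {..<r})" unfolding cardU[symmetric] by (rule card_mono[rotated]) simp
    also have "\<dots> \<le> r" using card_image_le[of "{..<r}"] by fastforce
    finally show False using card_UNIV_minus_one_pos[where ?'b = 'b] mod_less_divisor[of ?Q k]
      unfolding r_def by linarith
  qed
  then show "?Q dvd k" by (simp add: r_def dvd_eq_mod_eq_0)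
qed

lemma primitive_elem_root_power_eq_iff:
  fixes \<alpha> :: "'b::{finite,field}"
  assumes "primitive_elem \<alpha>" "n dvd card (UNIV :: 'b set) - 1" "n > 0"
  defines "\<beta> \<equiv> \<alpha> ^ ((card (UNIV :: 'b set) - 1) div n)"
  shows "\<beta> ^ i = \<beta> ^ j \<longleftrightarrow> [i = j] (mod n)"
proof -
  let ?Q = "card (UNIV :: 'b set) - 1"
  have a0: "\<alpha> \<noteq> 0" using assms(1) by (simp add: primitive_elem_def)
  have one: "\<beta> ^ k = 1 \<longleftrightarrow> n dvd k" for k
  proof -
    obtain c where c: "?Q = n * c" using assms(2) by blast
    then have "c > 0" "?Q div n = c" using card_UNIV_minus_one_pos[where ?'b = 'b] assms(3) by auto
    then show ?thesis unfolding \<beta>_def power_mult[symmetric] primitive_elem_power_eq_1_iff[OF assms(1)] c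
      by (simp add: mult.commute)
  qed
  have le: "\<beta> ^ i = \<beta> ^ j \<longleftrightarrow> [i = j] (mod n)" if "i \<le> j" for i j
  proof -
    have "\<beta> ^ j = \<beta> ^ i * \<beta> ^ (j - i)" using that by (simp flip: power_add)
    then have "\<beta> ^ i = \<beta> ^ j \<longleftrightarrow> \<beta> ^ (j - i) = 1" using a0 by (auto simp: \<beta>_def)
    also have "\<dots> \<longleftrightarrow> [j = i] (mod n)" unfolding one using that by (simp add: cong_altdef_nat)
    finally show ?thesis by (simp add: cong_sym_eq)
  qed
  show ?thesis using le[of i j] le[of j i] by (cases "i \<le> j") (auto simp: cong_sym_eq)
qed

text \<open>The characteristic is a prime dividing \<open>p ^ r\<close>, hence it is
  \<open>p\<close>, and \<open>q\<close> is a power of it.\<close>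

lemma finite_field_frobenius_add:
  fixes x y :: "'b::{finite,field}"
  assumes "prime p" "card (UNIV :: 'b set) = p ^ r" "q = p ^ k"
  shows "(x + y) ^ q = x ^ q + y ^ q"
proof -
  have "CHAR('b) > 0" by (rule finite_imp_CHAR_pos) simp
  then have prime: "prime CHAR('b)" by (rule prime_CHAR_semidom)
  moreover have "CHAR('b) dvd p ^ r" using CHAR_dvd_CARD[where ?'a = 'b] assms(2) by simp
  ultimately have "CHAR('b) = p"
    using assms(1) prime_dvd_power primes_dvd_imp_eq by blast
  then show ?thesis using freshmans_dream'[OF prime, of q k x y] assms(3) by simp
qed

section \<open>Parameters of the BCH codes\<close>

locale bch_code = bch_length q m n h t N + cyclic_frobenius q n \<beta>
  for q m n h t :: nat and N :: int and \<beta> :: "'b::field_gcd"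
begin

lemma n_dvd: "n dvd q ^ m + 1"
  using n_eq by simp

lemma cyclic_code_zero:
  assumes "c \<in> cyclic_code F n (root_poly (zeros b e))" "b \<le> i" "i \<le> e" "e < n"
  shows "poly (word_poly n c) (\<beta> ^ i) = 0"
proof -
  have "i \<in> zeros b e" unfolding zeros_def using assms self_in_cyc_coset[of i] by auto
  then show ?thesis using assms(1) unfolding cyclic_code_iff[OF q_closed_zeros] by blast
qed

text \<open>The exponents from \<open>1\<close> to \<open>\<delta> - 1\<close> form the run for the
  BCH bound. \<open>D\<close> stays free up to \<open>\<delta>\<close> so that the next smaller
  leader can be inserted.\<close>

lemma LCD_params_narrow_sense:
  assumes "1 \<le> \<delta>" "\<delta> \<le> n" "D \<le> \<delta>"
  shows "LCD_params q (cyclic_code F n (gen_poly F \<beta> \<delta> 1)) n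
    (\<Sum>a | a \<in> MinRep q n \<and> (a < 1 \<or> \<delta> - 1 < a). card (cyc_coset q n a)) D"
proof -
  have g: "gen_poly F \<beta> \<delta> 1 = root_poly (zeros 1 (\<delta> - 1))" unfolding gen_poly_eq by simp
  have "D \<le> weight c" if c: "c \<in> cyclic_code F n (root_poly (zeros 1 (\<delta> - 1)))" "c \<noteq> (\<lambda>_. 0)" for c
  proof -
    have "\<delta> - 1 < weight c"
    proof (rule BCH_bound)
      show "c \<in> words F n" using c unfolding cyclic_code_def by blast
      show "poly (word_poly n c) (\<beta> ^ (1 + i)) = 0" if "i < \<delta> - 1" for i
        using that assms by (intro cyclic_code_zero[OF c(1)]) auto
    qed fact
    then show ?thesis using assms by simp
  qed
  then show ?thesis
    unfolding LCD_params_def g min_dist_ge_def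
    using LCD_root_poly[OF n_dvd q_closed_zeros] code_dim_root_poly[OF q_closed_zeros, of 1 "\<delta> - 1"]
      card_compl_zeros[of 1 "\<delta> - 1"] assms by auto
qed

text \<open>With \<open>0\<close> among the zeros, closure under negation extends the run to all
  exponents from \<open>- (\<delta> - 1)\<close> to \<open>\<delta> - 1\<close>, which are
  \<open>2 * \<delta> - 1\<close> in number.\<close>

lemma LCD_params_with_zero:
  assumes "1 \<le> \<delta>" "\<delta> \<le> n" "D \<le> 2 * \<delta>"
  shows "LCD_params q (cyclic_code F n (gen_poly F \<beta> (\<delta> + 1) 0)) n
    (\<Sum>a | a \<in> MinRep q n \<and> (a < 0 \<or> \<delta> - 1 < a). card (cyc_coset q n a)) D"
proof -
  have g: "gen_poly F \<beta> (\<delta> + 1) 0 = root_poly (zeros 0 (\<delta> - 1))" unfolding gen_poly_eq by simp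
  have "D \<le> weight c" if c: "c \<in> cyclic_code F n (root_poly (zeros 0 (\<delta> - 1)))" "c \<noteq> (\<lambda>_. 0)" for c
  proof -
    have w: "c \<in> words F n" using c unfolding cyclic_code_def by blast
    have z: "poly (word_poly n c) (\<beta> ^ i) = 0" if "i < \<delta>" for i
      using that assms by (intro cyclic_code_zero[OF c(1)]) auto
    \<comment> \<open>Exponents are natural numbers, so the run starts at
      \<open>n - (\<delta> - 1)\<close> and passes through \<open>n\<close>.\<close>
    have "2 * \<delta> - 1 < weight c"
    proof (rule BCH_bound[OF w c(2)])
      fix i assume i: "i < 2 * \<delta> - 1"
      show "poly (word_poly n c) (\<beta> ^ (n - (\<delta> - 1) + i)) = 0"
      proof (cases "i < \<delta> - 1")
        case True
        then have "n - (\<delta> - 1) + i = n - (\<delta> - 1 - i)" using assms by simp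
        then show ?thesis using poly_neg_root[OF n_dvd w _ z[of "\<delta> - 1 - i"]] True assms by simp
      next
        case False
        then have "n - (\<delta> - 1) + i = n + (i - (\<delta> - 1))" using assms by simp
        then have "\<beta> ^ (n - (\<delta> - 1) + i) = \<beta> ^ (i - (\<delta> - 1))" by (simp add: power_eq_iff cong_def)
        then show ?thesis using z[of "i - (\<delta> - 1)"] i False by simp
      qed
    qed
    then show ?thesis using assms by simp
  qed
  then show ?thesis
    unfolding LCD_params_def g min_dist_ge_def
    using LCD_root_poly[OF n_dvd q_closed_zeros] code_dim_root_poly[OF q_closed_zeros, of 0 "\<delta> - 1"]
      card_compl_zeros[of 0 "\<delta> - 1"] assms by auto
qed

lemma leaders_above:
  defines "d \<equiv> delta_leader q n"
  assumes "d 4 < \<delta>" "\<delta> \<le> d 2"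
  shows "{a. a \<in> MinRep q n \<and> (a < b \<or> \<delta> - 1 < a)} =
    {a \<in> MinRep q n. a < b} \<union> (if \<delta> \<le> d 3 then {d 1, d 2, d 3} else {d 1, d 2})"
proof -
  have "{a \<in> MinRep q n. \<delta> - 1 < a} = (if \<delta> \<le> d 3 then {d 1, d 2, d 3} else {d 1, d 2})"
    using leaders(1-5) leaders(6) second_eq(2) h_MinRep second_MinRep assms(2,3)
    unfolding d_def by (auto split: if_splits) fastforce+
  then show ?thesis by blast
qed

text \<open>The coset \<open>{0}\<close> contributes \<open>b\<close>, the cosets of the two largest
  leaders contribute \<open>1 + 4\<close>, and the third one \<open>2 * m\<close> as long as
  \<open>\<delta>\<close> has not passed its leader.\<close>

lemma sum_leaders_above:
  defines "d \<equiv> delta_leader q n"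
  assumes "d 4 < \<delta>" "\<delta> \<le> d 2" "b \<le> 1"
  shows "(\<Sum>a | a \<in> MinRep q n \<and> (a < b \<or> \<delta> - 1 < a). card (cyc_coset q n a))
    = b + (if \<delta> \<le> d 3 then 2 * m + 5 else 5)"
proof -
  have "{a \<in> MinRep q n. a < b} = (if b = 0 then {} else {0})"
    using assms(4) zero_MinRep by auto
  moreover have "d 1 \<noteq> d 2" "d 1 \<noteq> d 3" "d 2 \<noteq> d 3" "d 1 > 0" "d 2 > 0" "d 3 > 0"
    using leaders(1-5) second_eq unfolding d_def by auto
  moreover have "card (cyc_coset q n (d 1)) = 1" "card (cyc_coset q n (d 2)) = 4"
    "card (cyc_coset q n (d 3)) = 2 * m"
    using card_cyc_coset_h card_cyc_coset_second card_cyc_coset_third leaders(1,2) unfolding d_def by auto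
  ultimately show ?thesis
    unfolding leaders_above[OF assms(2,3)[unfolded d_def], folded d_def]
    using assms(4) by (cases "b = 0") (auto simp: cyc_coset_0)
qed

end

theorem theorem2:
  fixes q t :: nat and \<alpha> :: "'b::{finite,field_gcd}"
  defines "m \<equiv> 4 * t + 2"
  defines "n \<equiv> q ^ m + 1"
  assumes "prime_power q" and "odd q"
    and "card (UNIV :: 'b set) = q ^ ord n q"
    and "primitive_elem \<alpha>"
  shows "(\<forall>\<delta>. delta_leader q n 3 + 1 \<le> \<delta> \<and> \<delta> \<le> delta_leader q n 2 \<longrightarrow>
            LCD_params q (BCH_code n q \<alpha> \<delta> 1) n 6 (delta_leader q n 3))
       \<and> (\<forall>\<delta>. delta_leader q n 4 + 1 \<le> \<delta> \<and> \<delta> \<le> delta_leader q n 3 \<longrightarrow>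
            LCD_params q (BCH_code n q \<alpha> \<delta> 1) n (2 * m + 6) (delta_leader q n 4))
       \<and> (\<forall>\<delta>. delta_leader q n 3 + 1 \<le> \<delta> \<and> \<delta> \<le> delta_leader q n 2 \<longrightarrow>
            LCD_params q (BCH_code n q \<alpha> (\<delta> + 1) 0) n 5 (2 * delta_leader q n 3))
       \<and> (\<forall>\<delta>. delta_leader q n 4 + 1 \<le> \<delta> \<and> \<delta> \<le> delta_leader q n 3 \<longrightarrow>
            LCD_params q (BCH_code n q \<alpha> (\<delta> + 1) 0) n (2 * m + 5) (2 * delta_leader q n 4))"
proof -
  obtain p k where pk: "prime p" "k > 0" "q = p ^ k" using assms(3) unfolding prime_power_def by blast
  have "q > 1" unfolding pk(3) using pk(1,2) prime_gt_1_nat by (intro one_less_power) auto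
  then have q3: "q \<ge> 3" using \<open>odd q\<close> by (cases "q = 2") auto
  define h where "h = n div 2"
  have n_2h: "n = 2 * h" unfolding h_def n_def using \<open>odd q\<close> by simp
  obtain N where "int q ^ (4 * t + 2) + 1 = ((int q)\<^sup>2 + 1) * N"
    using square_plus_one_dvd[of "int q" t] by blast
  then have N: "((int q)\<^sup>2 + 1) * N = int n" unfolding n_def m_def by simp
  interpret bch_length q m n h t N
    by standard (use q3 \<open>odd q\<close> n_2h N in \<open>auto simp: n_def m_def\<close>)
  define \<beta> where "\<beta> = \<alpha> ^ ((q ^ ord n q - 1) div n)"
  have "n dvd q ^ ord n q - 1"
    by (rule cong_to_1_nat[OF ord])
  then have "\<beta> ^ i = \<beta> ^ j \<longleftrightarrow> [i = j] (mod n)" for i j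
    using primitive_elem_root_power_eq_iff[OF assms(6), of n i j] n_gt_1 unfolding \<beta>_def assms(5) by simp
  moreover have "(x + y) ^ q = x ^ q + y ^ q" for x y :: 'b
    by (rule finite_field_frobenius_add[OF pk(1) _ pk(3), of "k * ord n q"])
      (simp add: assms(5) pk(3) power_mult)
  ultimately interpret bch_code q m n h t N \<beta>
    by unfold_locales (use q3 in auto)
  let ?d = "delta_leader q n"
  have BCH: "BCH_code n q \<alpha> \<delta> b = cyclic_code F n (gen_poly F \<beta> \<delta> b)" for \<delta> b
    unfolding BCH_code_def \<beta>_def ..
  have ord: "?d 4 < ?d 3" "?d 3 < ?d 2" "?d 2 < n"
    using leaders second_eq(2) n_2h by auto
  \<comment> \<open>Both ranges of \<open>\<delta>\<close> at once: comparison with the third leader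
    decides whether its coset lies outside the zeros.\<close>
  have narrow: "LCD_params q (BCH_code n q \<alpha> \<delta> 1) n (if \<delta> \<le> ?d 3 then 2 * m + 6 else 6) D"
    if "?d 4 < \<delta>" "\<delta> \<le> ?d 2" "D \<le> \<delta>" for \<delta> D
    using LCD_params_narrow_sense[of \<delta> D] sum_leaders_above[of \<delta> 1] that ord
    unfolding BCH by (auto simp: add.commute split: if_splits)
  have with_zero: "LCD_params q (BCH_code n q \<alpha> (\<delta> + 1) 0) n (if \<delta> \<le> ?d 3 then 2 * m + 5 else 5) D"
    if "?d 4 < \<delta>" "\<delta> \<le> ?d 2" "D \<le> 2 * \<delta>" for \<delta> D
    using LCD_params_with_zero[of \<delta> D] sum_leaders_above[of \<delta> 0] that ord
    unfolding BCH by (auto split: if_splits)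
  show ?thesis
  proof (intro conjI allI impI)
    fix \<delta> assume a: "?d 3 + 1 \<le> \<delta> \<and> \<delta> \<le> ?d 2"
    show "LCD_params q (BCH_code n q \<alpha> \<delta> 1) n 6 (?d 3)"
      using narrow[of \<delta> "?d 3"] a ord by auto
    show "LCD_params q (BCH_code n q \<alpha> (\<delta> + 1) 0) n 5 (2 * ?d 3)"
      using with_zero[of \<delta> "2 * ?d 3"] a ord by auto
  next
    fix \<delta> assume a: "?d 4 + 1 \<le> \<delta> \<and> \<delta> \<le> ?d 3"
    show "LCD_params q (BCH_code n q \<alpha> \<delta> 1) n (2 * m + 6) (?d 4)"
      using narrow[of \<delta> "?d 4"] a ord by auto
    show "LCD_params q (BCH_code n q \<alpha> (\<delta> + 1) 0) n (2 * m + 5) (2 * ?d 4)"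
      using with_zero[of \<delta> "2 * ?d 4"] a ord by auto
  qed
qed

end
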